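(* Let $B$ be a unital complex Banach algebra and let $A$ be a unital finite $C^*$-algebra (i.e. a unital $C^*$-algebra carrying a faithful tracial state). Let $T\colon B\to A$ be a surjective unital linear mapping which preserves invertible elements. Then $T$ is a Jordan homomorphism, that is, $T(a^2)=(Ta)^2$ for all $a\in B$.
   Context: All algebras are over $\mathbb{C}$. A unital $C^*$-algebra $A$ is called finite (in this paper's sense) if it has a faithful tracial state, i.e. a linear functional $\tau\colon A\to\mathbb{C}$ with $\tau(1)=1=\|\tau\|$, $\tau(ab)=\tau(ba)$ for all $a,b\in A$, and such that $\tau(a^*a)=0$ implies $a=0$ (such a functional is automatically positive and bounded). $G(B)$ and $G(A)$ denote the groups of invertible elements. A linear mapping $T\colon B\to A$ is unital if $T1=1$, and preserves invertible elements if $T(G(B))\subseteq G(A)$. No boundedness of $T$ is assumed. A Jordan homomorphism is a linear mapping $T$ with $T(a^2)=(Ta)^2$ for all $a$ in the domain. *)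

theory Defs
  imports "HOL-Analysis.Analysis"
begin

text \<open>Complex scalar multiplication extends the real one of the library classes, so that the
  norm, topology and completeness of those classes can be reused.\<close>

class scaleC = scaleR +
  fixes scaleC :: "complex \<Rightarrow> 'a \<Rightarrow> 'a"  (infixr "*\<^sub>C" 75)
  assumes scaleR_scaleC: "scaleR r x = scaleC (complex_of_real r) x"

class complex_vector = real_vector + scaleC +
  assumes scaleC_add_right: "a *\<^sub>C (x + y) = a *\<^sub>C x + a *\<^sub>C y"
    and scaleC_add_left: "(a + b) *\<^sub>C x = a *\<^sub>C x + b *\<^sub>C x"
    and scaleC_scaleC: "a *\<^sub>C (b *\<^sub>C x) = (a * b) *\<^sub>C x"
    and scaleC_one: "1 *\<^sub>C x = x"

text \<open>A unital Banach algebra is normed so that the unit has norm 1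
  (part of \<open>real_normed_algebra_1\<close>).\<close>

class complex_banach_algebra_1 = complex_vector + real_normed_algebra_1 + banach +
  assumes mult_scaleC_left: "(a *\<^sub>C x) * y = a *\<^sub>C (x * y)"
    and mult_scaleC_right: "x * (a *\<^sub>C y) = a *\<^sub>C (x * y)"
    and norm_scaleC: "norm (a *\<^sub>C x) = cmod a * norm x"

class cstar_algebra_1 = complex_banach_algebra_1 +
  fixes adj :: "'a \<Rightarrow> 'a"
  assumes adj_adj: "adj (adj x) = x"
    and adj_add: "adj (x + y) = adj x + adj y"
    and adj_scaleC: "adj (a *\<^sub>C x) = cnj a *\<^sub>C adj x"
    and adj_mult: "adj (x * y) = adj y * adj x"
    and norm_adj_mult: "norm (adj x * x) = (norm x)\<^sup>2"

instantiation complex :: cstar_algebra_1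
begin

definition scaleC_complex :: "complex \<Rightarrow> complex \<Rightarrow> complex"
  where "scaleC_complex a x = a * x"

definition adj_complex :: "complex \<Rightarrow> complex"
  where "adj_complex = cnj"

instance
  by standard
    (simp_all add: scaleC_complex_def adj_complex_def algebra_simps scaleR_conv_of_real
      norm_mult power2_eq_square)

end

abbreviation clinear :: "('a::complex_vector \<Rightarrow> 'b::complex_vector) \<Rightarrow> bool"
  where "clinear \<equiv> Vector_Spaces.linear scaleC scaleC"

lemma vector_space_scaleC: "vector_space (scaleC :: complex \<Rightarrow> 'a \<Rightarrow> 'a::complex_vector)"
  by standard (simp_all add: scaleC_add_right scaleC_add_left scaleC_scaleC scaleC_one)

lemma clinear_iff:
  "clinear f \<longleftrightarrow> (\<forall>x y. f (x + y) = f x + f y) \<and> (\<forall>c x. f (c *\<^sub>C x) = c *\<^sub>C f x)"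
  by (simp add: Vector_Spaces.linear_iff vector_space_scaleC)

text \<open>\<open>onorm\<close> is the operator norm only for bounded maps, whence the explicit boundedness.\<close>

definition faithful_tracial_state :: "('a::cstar_algebra_1 \<Rightarrow> complex) \<Rightarrow> bool"
  where "faithful_tracial_state \<tau> \<longleftrightarrow>
    clinear \<tau> \<and> bounded_linear \<tau> \<and> \<tau> 1 = 1 \<and> onorm \<tau> = 1 \<and>
    (\<forall>a b. \<tau> (a * b) = \<tau> (b * a)) \<and> (\<forall>a. \<tau> (adj a * a) = 0 \<longrightarrow> a = 0)"

definition invertibles :: "'a::monoid_mult set"
  where "invertibles = {a. \<exists>b. a * b = 1 \<and> b * a = 1}"

definition jordan_homomorphism ::
  "('b::complex_banach_algebra_1 \<Rightarrow> 'a::complex_banach_algebra_1) \<Rightarrow> bool"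
  where "jordan_homomorphism T \<longleftrightarrow> clinear T \<and> (\<forall>a. T (a\<^sup>2) = (T a)\<^sup>2)"

end

(*
Idea. Let tau be a faithful tracial state. For a curve F of invertible elements with F(0) = 1 the
primitive G of tau(F^-1 F') plays the role of log det F: since the derivative of tau(log(f* f)) / 2
along a path f is Re tau(f^-1 f'), one has Re G <= ln norm(F), and applying this to the powers of F,
Re G <= ln r for every r >= the spectral radius of F.
Take F(z) = T((1 + z a)^n (1 + z b)^n), a polynomial in z, so that no continuity of T is needed.
Invertibility preservation bounds its spectral radius by 4^n on a disc independent of n, hence
(Borel-Caratheodory, Cauchy) the Taylor coefficients of G are O(n).  Comparing the terms of order
n^2 in the second coefficient and of order n^3 in the third gives tau(T(ab)) = tau(Ta Tb) and
tau(T(a^3)) = tau((Ta)^3).  Polarizing the latter yields tau((T(a^2) - (Ta)^2) Tb) = 0 for all b, and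
surjectivity together with faithfulness finishes the proof.
*)

theory Submission
  imports Defs "HOL-Complex_Analysis.Complex_Analysis"
begin

section \<open>Square roots in C*-algebras\<close>


text \<open>As \<open>T\<close> may be unbounded, norms of its values cannot be estimated directly;
  only resolvents pass through it. Invertibility of \<open>1 - \<mu> x / R\<close> for
  \<open>cmod \<mu> \<le> 1\<close> gives \<open>norm (T x ^ m) \<le> C * R ^ m\<close> with an
  uncontrolled \<open>C\<close>, and division by \<open>m\<close> removes it. The exponent
  \<open>n\<close> serves to separate degrees: the traces obtained are polynomials in
  \<open>n\<close> of formal degree 2 and 3, whereas \<open>ln (4 ^ n)\<close> is linear in
  \<open>n\<close>, so the top coefficients must vanish. Two factors are taken because
  \<open>\<tau> \<circ> T\<close> is not known to be a trace: squares alone would control only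
  \<open>a * b + b * a\<close>. The order arguments rest on square roots found by iteration and on
  \<open>onorm \<tau> = 1\<close>; the norm bound that expresses positivity of
  \<open>adj x * x\<close> is itself derived from the faithful trace.\<close>

lemma norm_adj: "norm (adj x) = norm (x::'a::cstar_algebra_1)"
proof -
  have le: "norm y \<le> norm (adj y)" for y :: 'a
  proof (cases "y = 0")
    case False
    have "norm y * norm y \<le> norm (adj y) * norm y"
      using norm_adj_mult[of y] norm_mult_ineq[of "adj y" y] by (simp add: power2_eq_square)
    then show ?thesis using False by simp
  qed simp
  show ?thesis using le[of x] le[of "adj x"] by (simp add: adj_adj)
qed

lemma adj_scaleR: "adj (r *\<^sub>R x) = r *\<^sub>R adj (x::'a::cstar_algebra_1)"
  by (simp add: scaleR_scaleC adj_scaleC)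

lemma adj_one: "adj 1 = (1::'a::cstar_algebra_1)"
  by (metis adj_adj adj_mult mult_1_right)

lemma bounded_linear_adj: "bounded_linear (adj :: 'a::cstar_algebra_1 \<Rightarrow> 'a)"
  by (rule bounded_linear_intro[where K=1]) (simp_all add: adj_add adj_scaleR norm_adj)

lemma adj_zero: "adj 0 = (0::'a::cstar_algebra_1)"
  using linear_0[OF bounded_linear.linear[OF bounded_linear_adj]] .

lemma adj_diff: "adj (x - y) = adj x - adj (y::'a::cstar_algebra_1)"
  by (rule linear_diff[OF bounded_linear.linear[OF bounded_linear_adj]])

lemma scaleC_zero_left: "0 *\<^sub>C x = (0::'a::complex_vector)"
  using scaleR_scaleC[of 0 x] by simp

lemma scaleC_zero_right: "c *\<^sub>C 0 = (0::'a::complex_vector)"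
  by (metis scaleC_zero_left scaleC_scaleC mult_zero_right)

lemma scaleC_minus_left: "(- c) *\<^sub>C x = - (c *\<^sub>C (x::'a::complex_vector))"
  by (metis scaleC_add_left scaleC_zero_left eq_neg_iff_add_eq_0 neg_eq_iff_add_eq_0)

lemma scaleC_minus_right: "c *\<^sub>C (- x) = - (c *\<^sub>C (x::'a::complex_vector))"
  by (metis scaleC_add_right scaleC_zero_right eq_neg_iff_add_eq_0 neg_eq_iff_add_eq_0)

lemma scaleC_diff_right: "c *\<^sub>C (x - y) = c *\<^sub>C x - c *\<^sub>C (y::'a::complex_vector)"
  using scaleC_add_right[of c x "-y"] by (simp add: scaleC_minus_right)

lemma scaleR_scaleC_commute: "r *\<^sub>R (c *\<^sub>C x) = c *\<^sub>C (r *\<^sub>R (x::'a::complex_vector))"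
  by (simp add: scaleR_scaleC scaleC_scaleC mult.commute)

lemma power_scaleC: "(c *\<^sub>C x) ^ n = (c ^ n) *\<^sub>C ((x::'a::complex_banach_algebra_1) ^ n)"
  by (induction n)
    (simp_all add: scaleC_one mult_scaleC_left mult_scaleC_right scaleC_scaleC mult.commute)

text \<open>The square root is \<open>1 - y\<close> for the fixed point \<open>y = (h + y\<^sup>2) / 2\<close>; the increments of the
  iteration are dominated by those of the scalar iteration \<open>r = (1 + r\<^sup>2) / 2\<close>, which telescope.\<close>

lemma sqrt_one_minus:
  fixes h :: "'a::cstar_algebra_1"
  assumes h: "adj h = h" "norm h \<le> 1"
  obtains w where "adj w = w" "w * w = 1 - h" "norm (1 - w) \<le> 1"
    "\<And>z. z * h = h * z \<Longrightarrow> z * w = w * z"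
proof -
  define y where "y = rec_nat 0 (\<lambda>_ y. (1/2) *\<^sub>R (h + y * y))"
  define r :: "nat \<Rightarrow> real" where "r = rec_nat 0 (\<lambda>_ r. (1/2) * (1 + r * r))"
  have y0: "y 0 = 0" and yS: "y (Suc n) = (1/2) *\<^sub>R (h + y n * y n)" for n
    by (simp_all add: y_def)
  have r0: "r 0 = 0" and rS: "r (Suc n) = (1/2) * (1 + r n * r n)" for n
    by (simp_all add: r_def)
  have r_bd: "0 \<le> r n \<and> r n \<le> 1" for n
  proof (induction n)
    case (Suc n)
    then have "r n * r n \<le> 1 * 1" by (intro mult_mono) auto
    with Suc show ?case by (auto simp: rS)
  qed (simp add: r0)
  have y_bd: "norm (y n) \<le> r n" for n
  proof (induction n)
    case (Suc n)
    have "norm (y n * y n) \<le> r n * r n"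
      by (rule order_trans[OF norm_mult_ineq]) (use Suc r_bd in \<open>intro mult_mono, auto\<close>)
    then have "norm (h + y n * y n) \<le> 1 + r n * r n"
      using h(2) norm_triangle_ineq[of h "y n * y n"] by linarith
    then show ?case by (simp add: yS rS)
  qed (simp add: y0 r0)
  have y_comm: "z * y n = y n * z" if "z * h = h * z" for z n
  proof (induction n)
    case (Suc n)
    have "z * (y n * y n) = y n * y n * z"
      using Suc by (metis mult.assoc)
    then show ?case using that by (simp add: yS distrib_left distrib_right)
  qed (simp add: y0)
  have y_adj: "adj (y n) = y n" for n
    by (induction n) (simp_all add: y0 yS adj_zero adj_scaleR adj_add adj_mult h)
  have yy: "y m * y n = y n * y m" for m n
    by (rule y_comm) (rule y_comm[symmetric], simp)
  have r_step: "r n \<le> r (Suc n)" for n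
    using zero_le_power2[of "1 - r n"] by (simp add: rS power2_eq_square algebra_simps)
  have y_step: "norm (y (Suc n) - y n) \<le> r (Suc n) - r n" for n
  proof (induction n)
    case 0
    then show ?case using y_bd[of "Suc 0"] by (simp add: y0 r0)
  next
    case (Suc n)
    have eq: "y (Suc (Suc n)) - y (Suc n) = (1/2) *\<^sub>R ((y (Suc n) - y n) * (y (Suc n) + y n))"
      by (subst yS, subst (3) yS) (simp add: algebra_simps yy)
    have "norm ((y (Suc n) - y n) * (y (Suc n) + y n)) \<le> (r (Suc n) - r n) * (r (Suc n) + r n)"
      by (rule order_trans[OF norm_mult_ineq], rule mult_mono[OF _ _ _ norm_ge_zero])
        (use Suc y_bd r_bd r_step in
          \<open>auto intro!: order_trans[OF norm_triangle_ineq] add_mono\<close>)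
    also have "\<dots> = 2 * (r (Suc (Suc n)) - r (Suc n))"
      by (subst (2) rS, subst (5) rS) (simp add: algebra_simps)
    finally show ?case by (simp add: eq)
  qed
  have "incseq r"
    by (rule incseq_SucI) (rule r_step)
  moreover have "bdd_above (range r)" using r_bd by (intro bdd_aboveI[of _ 1]) auto
  ultimately have "convergent r"
    by (intro convergentI[OF LIMSEQ_incseq_SUP])
  then have "summable (\<lambda>n. r (Suc n) - r n)"
    by (auto simp: convergent_def intro: telescope_summable)
  then have "summable (\<lambda>n. y (Suc n) - y n)"
    by (rule summable_comparison_test[rotated]) (use y_step in blast)
  then have "convergent (\<lambda>n. \<Sum>i<n. y (Suc i) - y i)"
    by (simp add: summable_iff_convergent)
  then have "convergent y" by (simp add: sum_lessThan_telescope y0)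
  then obtain Y where Y: "y \<longlonglongrightarrow> Y" by (auto simp: convergent_def)
  have "(\<lambda>n. y (Suc n)) \<longlonglongrightarrow> (1/2) *\<^sub>R (h + Y * Y)"
    unfolding yS by (intro tendsto_intros Y)
  then have Yeq: "Y = (1/2) *\<^sub>R (h + Y * Y)"
    using LIMSEQ_Suc[OF Y] LIMSEQ_unique by blast
  have Ynorm: "norm Y \<le> 1"
    by (rule Lim_norm_ubound[OF _ Y]) (auto intro!: always_eventually order_trans[OF y_bd] simp: r_bd)
  have Yadj: "adj Y = Y"
    using LIMSEQ_unique[OF bounded_linear.tendsto[OF bounded_linear_adj Y, unfolded y_adj] Y] .
  have "2 *\<^sub>R Y = h + Y * Y" by (subst (1) Yeq) simp
  then have sq: "(1 - Y) * (1 - Y) = 1 - h"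
    by (simp add: algebra_simps scaleR_2)
  have comm: "z * (1 - Y) = (1 - Y) * z" if "z * h = h * z" for z
  proof -
    have "(\<lambda>n. z * y n) \<longlonglongrightarrow> z * Y" "(\<lambda>n. y n * z) \<longlonglongrightarrow> Y * z" 
      by (intro tendsto_intros Y)+
    then have "z * Y = Y * z" unfolding y_comm[OF that] by (rule LIMSEQ_unique)
    then show ?thesis by (simp add: algebra_simps)
  qed
  show thesis
    by (rule that[OF _ sq _ comm]) (simp_all add: adj_diff adj_one Yadj Ynorm)
qed

text \<open>For \<open>w = sqrt (1 - h\<^sup>2)\<close> the element \<open>u = h + \<i> w\<close> is unitary and
  \<open>2 (2 h\<^sup>2 - 1) = u\<^sup>2 + (adj u)\<^sup>2\<close>.\<close>

lemma norm_two_square_minus_one: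
  fixes h :: "'a::cstar_algebra_1"
  assumes h: "adj h = h" "norm h \<le> 1"
  shows "norm (2 *\<^sub>R (h * h) - 1) \<le> 1"
proof -
  have "norm (h * h) \<le> 1"
    using norm_adj_mult[of h] h by (simp add: power_le_one)
  moreover have "adj (h * h) = h * h" by (simp add: adj_mult h)
  ultimately obtain w where w: "adj w = w" "w * w = 1 - h * h"
      and comm: "\<And>z. z * (h * h) = h * h * z \<Longrightarrow> z * w = w * z"
    using sqrt_one_minus[of "h * h"] by metis
  have hw: "h * w = w * h" by (rule comm) (simp add: mult.assoc)
  define u where "u = h + \<i> *\<^sub>C w"
  have au: "adj u = h - \<i> *\<^sub>C w"
    by (simp add: u_def adj_add adj_scaleC h w scaleC_minus_left)
  have "adj u * u = 1"
    unfolding au unfolding u_def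
    by (simp add: algebra_simps mult_scaleC_left mult_scaleC_right scaleC_scaleC scaleC_minus_left
        scaleC_add_right scaleC_diff_right scaleC_one hw w)
  then have "(norm u)\<^sup>2 = 1" using norm_adj_mult[of u] by simp
  then have nu: "norm u = 1" using norm_ge_zero[of u] by (auto simp: power2_eq_1_iff)
  have "2 *\<^sub>R (2 *\<^sub>R (h * h) - 1) = u * u + adj u * adj u"
    unfolding au unfolding u_def
    by (simp add: algebra_simps mult_scaleC_left mult_scaleC_right scaleC_scaleC scaleC_minus_left
        scaleC_add_right scaleC_diff_right scaleC_one hw w scaleR_2)
  also have "norm \<dots> \<le> 1 + 1"
    by (rule order_trans[OF norm_triangle_ineq], rule add_mono; rule order_trans[OF norm_mult_ineq])
      (simp_all add: nu norm_adj)
  finally show ?thesis by simp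
qed

section \<open>Positivity via the trace\<close>


locale finite_cstar =
  fixes \<tau> :: "'a::cstar_algebra_1 \<Rightarrow> complex"
  assumes tracial: "faithful_tracial_state \<tau>"
begin

lemma tau_add: "\<tau> (x + y) = \<tau> x + \<tau> y"
  and tau_scaleC: "\<tau> (c *\<^sub>C x) = c * \<tau> x"
  using tracial by (auto simp: faithful_tracial_state_def clinear_iff scaleC_complex_def)

lemma bounded_linear_tau: "bounded_linear \<tau>"
  and tau_one: "\<tau> 1 = 1"
  and tau_commute: "\<tau> (x * y) = \<tau> (y * x)"
  and tau_faithful: "\<tau> (adj x * x) = 0 \<Longrightarrow> x = 0"
  using tracial by (auto simp: faithful_tracial_state_def)

lemma linear_tau: "linear \<tau>"
  by (rule bounded_linear.linear[OF bounded_linear_tau])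

lemmas tau_diff = linear_diff[OF linear_tau]
  and tau_minus = linear_neg[OF linear_tau]
  and tau_zero = linear_0[OF linear_tau]
  and tau_scaleR = linear_scale[OF linear_tau]
  and tau_sum = linear_sum[OF linear_tau]

lemma norm_tau_le: "cmod (\<tau> x) \<le> norm x"
  using onorm[OF bounded_linear_tau, of x] tracial by (simp add: faithful_tracial_state_def)

text \<open>Adding \<open>\<i> t\<close> to \<open>h\<close> shifts the imaginary part of the trace
  by \<open>t\<close>, but raises the bound for the squared norm only by the square of
  \<open>t\<close>. For large \<open>t\<close> of the right sign this is incompatible with a nonzero
  imaginary part.\<close>

lemma Im_tau_selfadjoint:
  assumes h: "adj h = h"
  shows "Im (\<tau> h) = 0"
proof (rule ccontr)
  assume nz: "Im (\<tau> h) \<noteq> 0"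
  define \<beta> where "\<beta> = Im (\<tau> h)"
  have ineq: "\<beta>\<^sup>2 + 2 * \<beta> * t \<le> (norm h)\<^sup>2" for t :: real
  proof -
    define x where "x = h + (\<i> * complex_of_real t) *\<^sub>C 1"
    have "adj x * x = h * h + (t\<^sup>2) *\<^sub>R 1"
      by (simp add: x_def adj_add adj_scaleC adj_one h algebra_simps mult_scaleC_left
          mult_scaleC_right scaleC_scaleC scaleR_scaleC power2_eq_square scaleC_minus_left
          scaleC_diff_right)
    then have "(norm x)\<^sup>2 \<le> norm (h * h) + norm ((t\<^sup>2) *\<^sub>R (1::'a))"
      by (metis norm_adj_mult norm_triangle_ineq)
    also have "\<dots> \<le> (norm h)\<^sup>2 + t\<^sup>2"
      using norm_mult_ineq[of h h] by (simp add: power2_eq_square)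
    finally have nx: "(norm x)\<^sup>2 \<le> (norm h)\<^sup>2 + t\<^sup>2" .
    have "Im (\<tau> x) = \<beta> + t"
      by (simp add: x_def tau_add tau_scaleC tau_one \<beta>_def)
    then have "\<bar>\<beta> + t\<bar> \<le> norm x"
      using abs_Im_le_cmod[of "\<tau> x"] norm_tau_le[of x] by simp
    then have "(\<beta> + t)\<^sup>2 \<le> (norm x)\<^sup>2"
      using power_mono[of "\<bar>\<beta> + t\<bar>" "norm x" 2] by simp
    with nx show ?thesis by (simp add: power2_eq_square algebra_simps)
  qed
  have b0: "\<beta> \<noteq> 0" using nz by (simp add: \<beta>_def)
  \<comment> \<open>This value of \<open>t\<close> makes the term linear in \<open>t\<close> exceed
    the right side of \<open>ineq\<close> by 1.\<close>
  have "2 * \<beta> * (((norm h)\<^sup>2 + 1) / (2 * \<beta>)) = (norm h)\<^sup>2 + 1"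
    using b0 by (simp add: field_simps)
  with ineq[of "((norm h)\<^sup>2 + 1) / (2 * \<beta>)"] show False
    using zero_le_power2[of \<beta>] by linarith
qed

lemma tau_adj: "\<tau> (adj x) = cnj (\<tau> x)"
proof -
  have "Im (\<tau> (x + adj x)) = 0"
    by (rule Im_tau_selfadjoint) (simp add: adj_add adj_adj)
  moreover have "Im (\<tau> (\<i> *\<^sub>C (x - adj x))) = 0"
    by (rule Im_tau_selfadjoint)
      (simp add: adj_scaleC adj_diff adj_adj scaleC_diff_right scaleC_minus_left)
  ultimately show ?thesis
    by (simp add: complex_eq_iff tau_add tau_scaleC tau_diff)
qed

text \<open>After normalization, \<open>2 h * h - 1\<close> is a contraction, so its trace has real
  part at least -1.\<close>

lemma Re_tau_square_nonneg:
  assumes c: "adj c = c"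
  shows "0 \<le> Re (\<tau> (c * c))"
proof (cases "c = 0")
  case False
  define h where "h = (1 / norm c) *\<^sub>R c"
  have "norm (2 *\<^sub>R (h * h) - 1) \<le> 1"
    by (rule norm_two_square_minus_one) (use False in \<open>simp_all add: h_def adj_scaleR c\<close>)
  then have "cmod (\<tau> (2 *\<^sub>R (h * h) - 1)) \<le> 1"
    using norm_tau_le order_trans by blast
  then have "- 1 \<le> Re (\<tau> (2 *\<^sub>R (h * h) - 1))"
    using abs_Re_le_cmod[of "\<tau> (2 *\<^sub>R (h * h) - 1)"] by linarith
  then have "0 \<le> Re (\<tau> (h * h))"
    by (simp add: tau_diff tau_scaleR tau_one)
  moreover have "c * c = (norm c)\<^sup>2 *\<^sub>R (h * h)"
    using False by (simp add: h_def power2_eq_square)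
  ultimately show ?thesis by (simp add: tau_scaleR)
qed (simp add: tau_zero)

text \<open>Positivity of \<open>h = adj x * x\<close>: for \<open>m = (\<bar>h\<bar> - h) / 2\<close> and \<open>y = x * m\<close> one has
  \<open>adj y * y = - m\<^sup>3\<close>, whereas \<open>y * adj y + adj y * y\<close> is a sum of squares. As the trace does not
  distinguish \<open>y * adj y\<close> from \<open>adj y * y\<close>, both vanish.\<close>

lemma norm_one_minus_adj_mult_le:
  fixes x :: 'a
  assumes x: "norm x \<le> 1"
  shows "norm (1 - adj x * x) \<le> 1"
proof -
  define h where "h = adj x * x"
  have ah: "adj h = h" by (simp add: h_def adj_mult adj_adj)
  have nh: "norm h \<le> 1" using x by (simp add: h_def norm_adj_mult power_le_one)
  \<comment> \<open>\<open>norm_two_square_minus_one\<close> says precisely that \<open>k\<close> is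
    a contraction, so \<open>1 - k\<close> has a square root \<open>w\<close>, which plays the role
    of \<open>sqrt 2\<close> times the absolute value of \<open>h\<close>. The bound on
    \<open>1 - w\<close> then permits a second root \<open>q\<close>.\<close>
  define k where "k = 1 - 2 *\<^sub>R (h * h)"
  have ak: "adj k = k" by (simp add: k_def adj_diff adj_scaleR adj_mult ah adj_one)
  have nk: "norm k \<le> 1"
    using norm_two_square_minus_one[OF ah nh] by (simp add: k_def norm_minus_commute)
  obtain w where w: "adj w = w" "w * w = 1 - k" "norm (1 - w) \<le> 1"
      and w_comm: "\<And>z. z * k = k * z \<Longrightarrow> z * w = w * z"
    using sqrt_one_minus[OF ak nk] by blast
  have aw: "adj (1 - w) = 1 - w" by (simp add: adj_diff adj_one w)
  obtain q where q: "adj q = q" "q * q = 1 - (1 - w)"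
      and q_comm: "\<And>z. z * (1 - w) = (1 - w) * z \<Longrightarrow> z * q = q * z"
    using sqrt_one_minus[OF aw w(3)] by blast
  \<comment> \<open>Rescaling removes the factor \<open>sqrt 2\<close>: \<open>s\<close> is the
    absolute value of \<open>h\<close>, and \<open>p\<close> is a square root of
    \<open>s\<close>.\<close>
  define c :: real where "c = 1 / sqrt 2"
  have c: "c > 0" "c * (c * 2) = 1" by (auto simp: c_def field_simps)
  define s where "s = c *\<^sub>R w"
  define p where "p = sqrt c *\<^sub>R q"
  have pp: "p * p = s" using c by (simp add: p_def s_def q)
  have ap: "adj p = p" and as: "adj s = s" by (simp_all add: p_def s_def adj_scaleR q w)
  have ss: "s * s = h * h" by (simp add: s_def w c k_def)
  have hw: "h * w = w * h"
    by (rule w_comm) (simp add: k_def algebra_simps)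
  have hs: "h * s = s * h" by (simp add: s_def hw)
  define m where "m = (1/2) *\<^sub>R (s - h)"
  have am: "adj m = m" by (simp add: m_def adj_scaleR adj_diff as ah)
  have mh: "m * h = - (m * s)" by (simp add: m_def algebra_simps hs ss)
  have mm: "m * m = m * s" 
  proof -
    have "m * m = (1/2) *\<^sub>R (m * s - m * h)" by (simp add: m_def right_diff_distrib)
    then show ?thesis by (simp add: mh flip: scaleR_2)
  qed
  have mw: "m * w = w * m" by (simp add: m_def s_def algebra_simps hw)
  have mq: "m * q = q * m" by (rule q_comm) (simp add: algebra_simps mw)
  have mp: "m * p = p * m" by (simp add: p_def mq)
  \<comment> \<open>The cube of \<open>m\<close> is the square of the selfadjoint \<open>e\<close>,
    so \<open>adj y * y\<close> is minus a square and has trace at most 0.\<close>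
  define e where "e = p * m"
  have ae: "adj e = e" by (simp add: e_def adj_mult ap am mp)
  have ee: "e * e = m * s * m" by (simp add: e_def mp[symmetric] pp[symmetric] mult.assoc)
  define y where "y = x * m"
  have "adj y * y = m * h * m" by (simp add: y_def adj_mult am h_def mult.assoc)
  then have yy: "adj y * y = - (e * e)" by (simp add: mh ee)
  define a where "a = y + adj y"
  define b where "b = \<i> *\<^sub>C (y - adj y)"
  have "adj a = a" "adj b = b"
    by (simp_all add: a_def b_def adj_add adj_scaleC adj_diff adj_adj scaleC_minus_left
        scaleC_diff_right)
  then have "0 \<le> Re (\<tau> (a * a + b * b))"
    using Re_tau_square_nonneg by (simp add: tau_add)
  moreover have "a * a + b * b = 2 *\<^sub>R (y * adj y + adj y * y)"
    by (simp add: a_def b_def algebra_simps mult_scaleC_left mult_scaleC_right scaleC_scaleC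
        scaleC_minus_left scaleC_one scaleC_diff_right scaleR_2)
  ultimately have "0 \<le> Re (\<tau> (adj y * y))"
    using tau_commute[of y "adj y"] by (simp add: tau_scaleR tau_add)
  moreover have "Re (\<tau> (adj y * y)) \<le> 0"
    using Re_tau_square_nonneg[OF ae] by (simp add: yy tau_minus)
  moreover have "Im (\<tau> (adj y * y)) = 0"
    by (rule Im_tau_selfadjoint) (simp add: adj_mult adj_adj)
  ultimately have "y = 0" by (intro tau_faithful) (simp add: complex_eq_iff)
  then have "m * m * m = 0" using yy by (simp add: mm ee)
  \<comment> \<open>A selfadjoint nilpotent vanishes: the C*-identity is applied to
    \<open>m * m\<close> and then to \<open>m\<close>.\<close>
  then have "adj (m * m) * (m * m) = 0" by (simp add: adj_mult am mult.assoc)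
  then have "adj m * m = 0" using norm_adj_mult[of "m * m"] by (simp add: am)
  then have "m = 0" using norm_adj_mult[of m] by simp
  then have sh: "h = p * p" by (simp add: m_def pp)
  have "norm p \<le> 1"
    using norm_adj_mult[of p] nh sh ap by (metis power2_le_iff_abs_le abs_norm_cancel one_power2 zero_le_one power2_eq_square mult_1)
  then have "norm (2 *\<^sub>R h - 1) \<le> 1"
    using norm_two_square_minus_one[OF ap] by (simp add: sh)
  moreover have "1 - h = (1/2) *\<^sub>R (1 - (2 *\<^sub>R h - 1))"
    by (simp add: algebra_simps flip: scaleR_2)
  moreover have "norm (1 - (2 *\<^sub>R h - 1)) \<le> norm (1::'a) + norm (2 *\<^sub>R h - 1)"
    by (rule norm_triangle_ineq4)
  ultimately show ?thesis by (simp add: h_def)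
qed

end

section \<open>Inverses in Banach algebras\<close>


lemma geometric_series_inverse:
  fixes x :: "'a::{real_normed_algebra_1,banach}"
  assumes "norm x < 1"
  shows "(1 - x) * (\<Sum>n. x ^ n) = 1" "(\<Sum>n. x ^ n) * (1 - x) = 1"
proof -
  have s: "summable (\<lambda>n. x ^ n)" by (rule complete_algebra_summable_geometric[OF assms])
  define y where "y = (\<Sum>n. x ^ n)"
  have "y = 1 + (\<Sum>n. x ^ Suc n)"
    unfolding y_def by (subst suminf_split_head[OF s]) simp
  moreover have "(\<Sum>n. x ^ Suc n) = x * y" "(\<Sum>n. x ^ Suc n) = y * x"
    unfolding y_def using suminf_mult[OF s, of x] suminf_mult2[OF s, of x]
    by (simp_all add: power_commutes)
  ultimately have y: "y = 1 + x * y" "y = 1 + y * x" by simp_all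
  have "(1 - x) * y = y - x * y" "y * (1 - x) = y - y * x" by (simp_all add: algebra_simps)
  then have "(1 - x) * y = 1" "y * (1 - x) = 1"
    using y by (metis add_diff_cancel_right')+
  then show "(1 - x) * (\<Sum>n. x ^ n) = 1" "(\<Sum>n. x ^ n) * (1 - x) = 1"
    by (simp_all add: y_def)
qed

lemma invertibles_one_minus:
  fixes x :: "'a::{real_normed_algebra_1,banach}"
  assumes "norm x < 1"
  shows "1 - x \<in> invertibles"
  using geometric_series_inverse[OF assms] by (auto simp: invertibles_def)

lemma invertibles_mult:
  fixes x y :: "'a::monoid_mult"
  assumes "x \<in> invertibles" "y \<in> invertibles"
  shows "x * y \<in> invertibles"
proof -
  obtain a b where a: "x * a = 1" "a * x = 1" and b: "y * b = 1" "b * y = 1"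
    using assms by (auto simp: invertibles_def)
  have "(x * y) * (b * a) = x * (y * b) * a" "(b * a) * (x * y) = b * (a * x) * y"
    by (simp_all add: mult.assoc)
  then have "(x * y) * (b * a) = 1" "(b * a) * (x * y) = 1" using a b by simp_all
  then show ?thesis unfolding invertibles_def by blast
qed

lemma invertibles_one: "1 \<in> invertibles"
  by (auto simp: invertibles_def)

lemma invertibles_power:
  "x \<in> invertibles \<Longrightarrow> (x::'a::monoid_mult) ^ n \<in> invertibles"
  by (induction n) (simp_all add: invertibles_one invertibles_mult)

lemma eventually_at_self: "\<forall>\<^sub>F w in at z within S. w \<in> S"
  by (simp add: eventually_at_filter)

text \<open>From \<open>g w - g z = g w * (f z - f w) * g z\<close> one first gets that
  \<open>norm (g w)\<close> is at most \<open>2 * norm (g z)\<close> near \<open>z\<close>; only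
  then does the same identity give convergence.\<close>

lemma inverse_continuous:
  fixes f g :: "'c::t2_space \<Rightarrow> 'a::real_normed_algebra_1"
  assumes S: "z \<in> S" and cont: "continuous (at z within S) f"
    and inv: "\<And>w. w \<in> S \<Longrightarrow> f w * g w = 1" "\<And>w. w \<in> S \<Longrightarrow> g w * f w = 1"
  shows "continuous (at z within S) g"
proof -
  have diff: "g w - g z = g w * (f z - f w) * g z" if "w \<in> S" for w
  proof -
    have "g w * (f z - f w) * g z = g w * (f z * g z) - (g w * f w) * g z"
      by (simp add: algebra_simps)
    then show ?thesis using inv[OF that] inv[OF S] by simp
  qed
  have f0: "((\<lambda>w. norm (f z - f w)) \<longlongrightarrow> 0) (at z within S)"
    using tendsto_norm[OF tendsto_diff[OF tendsto_const cont[unfolded continuous_within]], of "f z"]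
    by simp
  have lim: "((\<lambda>w. 2 * norm (g z) * norm (f z - f w) * norm (g z)) \<longlongrightarrow> 0) (at z within S)"
    using tendsto_mult[OF tendsto_mult[OF tendsto_const[of "2 * norm (g z)"] f0] tendsto_const[of "norm (g z)"]]
    by simp
  have f1: "((\<lambda>w. norm (f z - f w) * norm (g z)) \<longlongrightarrow> 0) (at z within S)"
    using tendsto_mult[OF f0 tendsto_const[of "norm (g z)"]] by simp
  have small: "\<forall>\<^sub>F w in at z within S. norm (f z - f w) * norm (g z) < 1/2"
    by (rule order_tendstoD(2)[OF f1]) simp
  have "\<forall>\<^sub>F w in at z within S.
      norm (g w - g z) \<le> 2 * norm (g z) * norm (f z - f w) * norm (g z)"
  proof (rule eventually_mono[OF eventually_conj[OF small eventually_at_self]])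
    fix w assume elim': "norm (f z - f w) * norm (g z) < 1/2 \<and> w \<in> S"
    then have elim: "norm (f z - f w) * norm (g z) < 1/2" "w \<in> S" by auto
    have le: "norm (g w - g z) \<le> norm (g w) * (norm (f z - f w) * norm (g z))"
      by (subst diff[OF elim(2)], subst mult.assoc, rule order_trans[OF norm_mult_ineq],
          rule mult_left_mono[OF norm_mult_ineq norm_ge_zero])
    also have "\<dots> \<le> norm (g w) * (1/2)"
      by (rule mult_left_mono) (use elim in auto)
    finally have "norm (g w) \<le> 2 * norm (g z)"
      using norm_triangle_ineq2[of "g w" "g z"] by linarith
    then have "norm (g w) * (norm (f z - f w) * norm (g z)) \<le>
        2 * norm (g z) * (norm (f z - f w) * norm (g z))"
      by (rule mult_right_mono) simp
    with le show "norm (g w - g z) \<le> 2 * norm (g z) * norm (f z - f w) * norm (g z)"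
      by (simp add: mult.assoc)
  qed
  then have "((\<lambda>w. g w - g z) \<longlongrightarrow> 0) (at z within S)"
    by (rule Lim_null_comparison[OF _ lim])
  then show ?thesis unfolding continuous_within by (simp add: LIM_zero_iff)
qed

text \<open>The remainder of \<open>g\<close> splits into the remainder of \<open>f\<close> between
  two inverses and a term with the factor \<open>g w - g z\<close>. The latter is negligible by
  continuity of \<open>g\<close>.\<close>

lemma has_derivative_inverse_mult:
  fixes f g :: "'c::real_normed_vector \<Rightarrow> 'a::real_normed_algebra_1"
  assumes S: "z \<in> S" and f: "(f has_derivative f') (at z within S)"
    and inv: "\<And>w. w \<in> S \<Longrightarrow> f w * g w = 1" "\<And>w. w \<in> S \<Longrightarrow> g w * f w = 1"
  shows "(g has_derivative (\<lambda>h. - (g z * f' h * g z))) (at z within S)"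
proof -
  have gz: "(g \<longlongrightarrow> g z) (at z within S)"
    using inverse_continuous[OF S has_derivative_continuous[OF f] inv]
    by (simp add: continuous_within)
  have diff: "g w - g z = - (g w * (f w - f z) * g z)" if "w \<in> S" for w
  proof -
    have "g w * (f w - f z) * g z = (g w * f w) * g z - g w * (f z * g z)"
      by (simp add: algebra_simps)
    then show ?thesis using inv[OF that] inv[OF S] by simp
  qed
  have "bounded_linear f'" using f by (rule has_derivative_bounded_linear)
  then have bl: "bounded_linear (\<lambda>h. - (g z * f' h * g z))"
    by (intro bounded_linear_minus bounded_linear_mult_const bounded_linear_const_mult)
  obtain K where K: "\<And>h. norm (f' h) \<le> norm h * K" "0 \<le> K"
    using bounded_linear.nonneg_bounded[OF \<open>bounded_linear f'\<close>] by blast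
  define e where "e w = (1 / norm (w - z)) *\<^sub>R (f w - f z - f' (w - z))" for w
  have e0: "(e \<longlongrightarrow> 0) (at z within S)"
    using f unfolding has_derivative_within e_def by (simp add: diff_diff_eq)
  have A: "((\<lambda>w. - (g w * e w * g z)) \<longlongrightarrow> 0) (at z within S)"
    using tendsto_minus[OF tendsto_mult[OF tendsto_mult[OF gz e0] tendsto_const[of "g z"]]] by simp
  have B0: "((\<lambda>w. norm (g w - g z) * (K * norm (g z))) \<longlongrightarrow> 0) (at z within S)"
    using tendsto_mult[OF tendsto_norm[OF tendsto_diff[OF gz tendsto_const[of "g z"]]]
        tendsto_const[of "K * norm (g z)"]] by simp
  have "\<forall>\<^sub>F w in at z within S.
      norm ((1 / norm (w - z)) *\<^sub>R ((g w - g z) * f' (w - z) * g z)) \<le> norm (g w - g z) * (K * norm (g z))"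
  proof (rule always_eventually, rule allI)
    fix w
    have "norm ((g w - g z) * f' (w - z) * g z) \<le> norm (g w - g z) * (norm (w - z) * K) * norm (g z)"
      by (rule order_trans[OF norm_mult_ineq], rule mult_right_mono,
          rule order_trans[OF norm_mult_ineq], rule mult_left_mono) (use K in auto)
    then show "norm ((1 / norm (w - z)) *\<^sub>R ((g w - g z) * f' (w - z) * g z)) \<le>
        norm (g w - g z) * (K * norm (g z))"
      unfolding norm_scaleR by (cases "w = z") (simp_all add: divide_simps mult_ac)
  qed
  then have B: "((\<lambda>w. (1 / norm (w - z)) *\<^sub>R ((g w - g z) * f' (w - z) * g z)) \<longlongrightarrow> 0) (at z within S)"
    by (rule Lim_null_comparison[OF _ B0])
  have "((\<lambda>w. - (g w * e w * g z) - (1 / norm (w - z)) *\<^sub>R ((g w - g z) * f' (w - z) * g z))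
      \<longlongrightarrow> 0) (at z within S)"
    using tendsto_diff[OF A B] by simp
  moreover have "- (g w * e w * g z) - (1 / norm (w - z)) *\<^sub>R ((g w - g z) * f' (w - z) * g z) =
      (1 / norm (w - z)) *\<^sub>R (g w - g z - - (g z * f' (w - z) * g z))" if w: "w \<in> S" for w
  proof -
    have "- (g w * e w * g z) =
        (1 / norm (w - z)) *\<^sub>R (- (g w * (f w - f z) * g z) + g w * f' (w - z) * g z)"
      by (simp add: e_def algebra_simps)
    then show ?thesis unfolding diff[OF w, symmetric] by (simp add: algebra_simps)
  qed
  then have "\<forall>\<^sub>F w in at z within S.
      - (g w * e w * g z) - (1 / norm (w - z)) *\<^sub>R ((g w - g z) * f' (w - z) * g z) =
      (1 / norm (w - z)) *\<^sub>R (g w - g z - - (g z * f' (w - z) * g z))"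
    by (intro eventually_mono[OF eventually_at_self])
  ultimately have "((\<lambda>w. (1 / norm (w - z)) *\<^sub>R (g w - g z - - (g z * f' (w - z) * g z)))
      \<longlongrightarrow> 0) (at z within S)"
    by (rule Lim_transform_eventually)
  then show ?thesis
    unfolding has_derivative_within using bl by (simp add: diff_diff_eq add.commute algebra_simps)
qed

section \<open>The norm bound for the logarithm of the determinant\<close>


text \<open>The noncommutative derivative of \<open>x ^ n\<close> in direction \<open>d\<close>,
  that is, the sum of all \<open>x ^ i * d * x ^ (n - 1 - i)\<close> with
  \<open>i < n\<close>.\<close>

primrec pow_deriv :: "'a::ring_1 \<Rightarrow> 'a \<Rightarrow> nat \<Rightarrow> 'a" where
  "pow_deriv x d 0 = 0"
| "pow_deriv x d (Suc n) = x * pow_deriv x d n + d * x ^ n"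

lemma has_vector_derivative_pow:
  fixes f :: "real \<Rightarrow> 'a::real_normed_algebra_1"
  assumes "(f has_vector_derivative d) (at t within S)"
  shows "((\<lambda>t. f t ^ n) has_vector_derivative pow_deriv (f t) d n) (at t within S)"
proof (induction n)
  case (Suc n)
  show ?case using has_vector_derivative_mult[OF assms Suc] by simp
qed simp

lemma adj_power: "adj (x ^ n) = adj (x::'a::cstar_algebra_1) ^ n"
  by (induction n) (simp_all add: adj_one adj_mult power_commutes)

lemma minus_ln_one_minus_sums:
  fixes x :: real
  assumes "0 \<le> x" "x < 1"
  shows "(\<lambda>n. x ^ Suc n / Suc n) sums - ln (1 - x)"
proof -
  have "(\<lambda>n. - (x ^ n) / of_nat n) sums ln (1 - x)"
    using ln_series'[of "- x"] assms by simp
  then have "(\<lambda>n. x ^ n / of_nat n) sums - ln (1 - x)"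
    using sums_minus by fastforce
  \<comment> \<open>The term at 0 is a division by 0, hence 0, and the shift of the index loses
    nothing.\<close>
  then show ?thesis by (subst sums_Suc_iff) simp
qed

context finite_cstar
begin

text \<open>Under the trace each summand of \<open>pow_deriv\<close> can be rotated until
  \<open>d\<close> stands last. Generalizing over \<open>c\<close> lets the induction absorb the
  leading \<open>x\<close> into \<open>c\<close>.\<close>

lemma tau_pow_deriv:
  assumes "c * x = x * c"
  shows "\<tau> (c * pow_deriv x d n) = of_nat n * \<tau> (c * x ^ (n - 1) * d)"
  using assms
proof (induction n arbitrary: c)
  case (Suc n)
  have "(c * x) * x = x * (c * x)" using Suc.prems by (simp add: mult.assoc)
  from Suc.IH[OF this] have "\<tau> (c * x * pow_deriv x d n) = of_nat n * \<tau> (c * x ^ n * d)"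
    by (cases n) (simp_all add: mult.assoc)
  moreover have "c * x ^ n = x ^ n * c"
    using Suc.prems by (metis power_commuting_commutes)
  then have "\<tau> (c * d * x ^ n) = \<tau> (c * x ^ n * d)"
    using tau_commute[of "c * d" "x ^ n"] by (simp add: mult.assoc)
  ultimately show ?case
    by (simp add: distrib_left tau_add mult.assoc[symmetric]) (simp add: algebra_simps)
qed (simp add: tau_zero)

lemma Re_tau_even_power_nonneg:
  assumes "adj w = w"
  shows "0 \<le> Re (\<tau> (w ^ (2 * j)))"
  using Re_tau_square_nonneg[of "w ^ j"] assms
  by (simp add: adj_power mult_2 power_add)

text \<open>In the expansion of the power every term is a nonnegative multiple of an even power of
  \<open>w\<close>, and all but the first are dropped. The extra factor \<open>w ^ (2 * j)\<close>
  makes the induction close.\<close>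

lemma Re_tau_power_ge:
  assumes w: "adj w = w" and \<kappa>: "0 \<le> \<kappa>"
  shows "\<kappa> ^ n * Re (\<tau> (w ^ (2 * j))) \<le> Re (\<tau> ((\<kappa> *\<^sub>R 1 + w * w) ^ n * w ^ (2 * j)))"
proof (induction n arbitrary: j)
  case (Suc n)
  let ?X = "\<kappa> *\<^sub>R 1 + w * w"
  have "?X ^ Suc n * w ^ (2 * j) = \<kappa> *\<^sub>R (?X ^ n * w ^ (2 * j)) + ?X ^ n * w ^ (2 * Suc j)"
    unfolding power_Suc2 by (simp add: distrib_left distrib_right mult.assoc)
  then have "Re (\<tau> (?X ^ Suc n * w ^ (2 * j))) =
      \<kappa> * Re (\<tau> (?X ^ n * w ^ (2 * j))) + Re (\<tau> (?X ^ n * w ^ (2 * Suc j)))"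
    by (simp add: tau_add tau_scaleR)
  moreover have "\<kappa> * (\<kappa> ^ n * Re (\<tau> (w ^ (2 * j)))) \<le> \<kappa> * Re (\<tau> (?X ^ n * w ^ (2 * j)))"
    by (rule mult_left_mono[OF Suc \<kappa>])
  moreover have "0 \<le> \<kappa> ^ n * Re (\<tau> (w ^ (2 * Suc j)))"
    using Re_tau_even_power_nonneg[OF w, of "Suc j"] \<kappa> by simp
  ultimately show ?case using Suc[of "Suc j"] by (simp add: mult.assoc)
qed simp

text \<open>The base exceeds the scalar \<open>1 - (norm f)\<^sup>2 / M\<close> by the square of a
  selfadjoint element, so \<open>Re_tau_power_ge\<close> applies.\<close>

lemma Re_tau_power_one_minus_ge:
  fixes f :: 'a
  assumes f: "f \<noteq> 0" and M: "(norm f)\<^sup>2 \<le> M"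
  shows "(1 - (norm f)\<^sup>2 / M) ^ n \<le> Re (\<tau> ((1 - (1 / M) *\<^sub>R (adj f * f)) ^ n))"
proof -
  define P where "P = (norm f)\<^sup>2"
  have P: "P > 0" "P \<le> M" using f M by (auto simp: P_def)
  define h where "h = (1 / P) *\<^sub>R (adj f * f)"
  have "adj h = h" by (simp add: h_def adj_scaleR adj_mult adj_adj)
  moreover have "norm h \<le> 1" using P by (simp add: h_def norm_adj_mult P_def)
  ultimately obtain v where v: "adj v = v" "v * v = 1 - h"
    using sqrt_one_minus by metis
  define w where "w = sqrt (P / M) *\<^sub>R v"
  have "w * w = (P / M) *\<^sub>R (1 - h)" using P by (simp add: w_def v)
  then have "(1 - P / M) *\<^sub>R 1 + w * w = 1 - (1 / M) *\<^sub>R (adj f * f)"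
    using P by (simp add: h_def algebra_simps)
  moreover have "adj w = w" by (simp add: w_def adj_scaleR v)
  moreover have "0 \<le> 1 - P / M" using P by (simp add: divide_simps)
  ultimately show ?thesis
    using Re_tau_power_ge[of w "1 - P / M" n 0] by (simp add: tau_one P_def)
qed

text \<open>The bound on the inverse keeps \<open>adj f * f\<close> above
  \<open>\<delta> = 1 / K\<^sup>2\<close>, and the bound on \<open>f\<close> keeps the excess below
  \<open>N\<close>. After division by \<open>M = N + \<delta>\<close> the distance to 1 is therefore
  at most \<open>1 - \<delta> / M = N / M\<close>.\<close>

lemma norm_one_minus_adj_mult_less:
  fixes f g :: 'a
  assumes inv: "f * g = 1" "g * f = 1" and K: "norm f \<le> K" "norm g \<le> K" "1 \<le> K"
    and N: "N = K\<^sup>2 + 1" and M: "M = N + 1 / K\<^sup>2"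
  shows "norm (1 - (1 / M) *\<^sub>R (adj f * f)) \<le> N / M"
proof -
  define \<delta> where "\<delta> = 1 / K\<^sup>2"
  have K1: "1 \<le> K\<^sup>2" using K(3) by (simp add: one_le_power)
  then have \<delta>: "0 < \<delta>" "\<delta> \<le> 1" by (auto simp: \<delta>_def divide_simps)
  have N0: "N > 0" using K1 by (simp add: N)
  have M': "M = N + \<delta>" by (simp add: M \<delta>_def)
  then have M0: "M = N + \<delta>" "M > 0" using N0 \<delta> by auto
  define h where "h = \<delta> *\<^sub>R (adj g * g)"
  have ah: "adj h = h" by (simp add: h_def adj_scaleR adj_mult adj_adj)
  have "(norm g)\<^sup>2 \<le> K\<^sup>2" using K(2) by (simp add: power_mono)
  then have "norm h \<le> 1" using K1 by (simp add: h_def norm_adj_mult \<delta>_def divide_simps)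
  with ah obtain v where v: "adj v = v" "v * v = 1 - h"
    using sqrt_one_minus by metis
  \<comment> \<open>Chosen so that \<open>adj x * x\<close> is \<open>adj f * f - \<delta>\<close>:
    the subtracted part \<open>adj f * h * f\<close> collapses because \<open>g\<close> inverts
    \<open>f\<close>.\<close>
  define x where "x = v * f"
  have "adj f * h * f = \<delta> *\<^sub>R ((adj f * adj g) * (g * f))"
    by (simp add: h_def mult.assoc)
  also have "\<dots> = \<delta> *\<^sub>R 1" by (simp add: inv adj_one flip: adj_mult)
  finally have fhf: "adj f * h * f = \<delta> *\<^sub>R 1" .
  have "adj x * x = adj f * (v * v) * f" by (simp add: x_def adj_mult v(1) mult.assoc)
  then have xx: "adj x * x = adj f * f - \<delta> *\<^sub>R 1"
    by (simp add: v(2) right_diff_distrib left_diff_distrib fhf)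
  have "(norm x)\<^sup>2 \<le> norm (adj f * f) + norm (\<delta> *\<^sub>R (1::'a))"
    unfolding norm_adj_mult[symmetric] xx by (rule norm_triangle_ineq4)
  also have "\<dots> \<le> K\<^sup>2 + 1"
    using K(1) \<delta> by (simp add: norm_adj_mult add_mono power_mono)
  finally have nx: "(norm x)\<^sup>2 \<le> N" by (simp add: N)
  define y where "y = (1 / sqrt N) *\<^sub>R x"
  have "norm x \<le> sqrt N" using nx by (simp add: real_le_rsqrt)
  then have "norm y \<le> 1" using N0 by (simp add: y_def)
  then have ny: "norm (1 - adj y * y) \<le> 1" by (rule norm_one_minus_adj_mult_le)
  have "adj f * f = N *\<^sub>R (adj y * y) + \<delta> *\<^sub>R 1"
    using N0 by (simp add: y_def adj_scaleR xx)
  then have "1 - (1 / M) *\<^sub>R (adj f * f) = (1 - \<delta> / M) *\<^sub>R 1 - (N / M) *\<^sub>R (adj y * y)"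
    by (simp add: algebra_simps)
  also have "1 - \<delta> / M = N / M" using M0 by (simp add: field_simps)
  finally have "1 - (1 / M) *\<^sub>R (adj f * f) = (N / M) *\<^sub>R (1 - adj y * y)"
    by (simp add: algebra_simps)
  then have "norm (1 - (1 / M) *\<^sub>R (adj f * f)) = (N / M) * norm (1 - adj y * y)"
    using N0 M0 by simp
  also have "\<dots> \<le> (N / M) * 1" by (rule mult_left_mono[OF ny]) (use N0 M0 in simp)
  finally show ?thesis by simp
qed

text \<open>The function \<open>\<Psi>\<close> of the proof is the trace of \<open>- log (adj f * f / M)\<close>, expanded in powers of
  \<open>k = 1 - adj f * f / M\<close>, where \<open>M\<close> is so large that \<open>norm k\<close> stays away from 1 on the whole path.\<close>

lemma Re_tau_logarithmic_derivative_le: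
  fixes f f' g :: "real \<Rightarrow> 'a"
  assumes f0: "f 0 = 1"
    and f: "\<And>t. t \<in> {0..1} \<Longrightarrow> (f has_vector_derivative f' t) (at t within {0..1})"
    and f': "continuous_on {0..1} f'"
    and fg: "\<And>t. t \<in> {0..1} \<Longrightarrow> f t * g t = 1" and gf: "\<And>t. t \<in> {0..1} \<Longrightarrow> g t * f t = 1"
    and u: "\<And>t. t \<in> {0..1} \<Longrightarrow> (u has_real_derivative Re (\<tau> (g t * f' t))) (at t within {0..1})"
  shows "u 1 - u 0 \<le> ln (norm (f 1))"
proof -
  let ?I = "{0..1::real}"
  have cf: "continuous_on ?I f"
    by (rule continuous_on_vector_derivative[OF f])
  have cg: "continuous_on ?I g"
    using cf unfolding continuous_on_eq_continuous_within
    by (auto intro: inverse_continuous[where f=f, OF _ _ fg gf])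
  have bdd: "\<exists>K. \<forall>t\<in>?I. norm (h t) \<le> K" if "continuous_on ?I h" for h :: "real \<Rightarrow> 'a"
    using compact_imp_bounded[OF compact_continuous_image[OF that compact_Icc]]
    unfolding bounded_iff by auto
  obtain K1 K2 K3 where "\<forall>t\<in>?I. norm (f t) \<le> K1" "\<forall>t\<in>?I. norm (g t) \<le> K2" "\<forall>t\<in>?I. norm (f' t) \<le> K3"
    using bdd[OF cf] bdd[OF cg] bdd[OF f'] by blast
  moreover define K where "K = max 1 (max K1 (max K2 K3))"
  ultimately have K: "norm (f t) \<le> K" "norm (g t) \<le> K" "norm (f' t) \<le> K" "1 \<le> K" if "t \<in> ?I" for t
    using that by fastforce+
  define N where "N = K\<^sup>2 + 1"
  define M where "M = N + 1 / K\<^sup>2"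
  have K1: "1 \<le> K" using K[of 0] by simp
  then have KK: "1 \<le> K\<^sup>2" by (simp add: one_le_power)
  then have d: "0 < 1 / K\<^sup>2" using K1 by simp
  have N: "0 < N" "K\<^sup>2 \<le> N" using KK by (simp_all add: N_def)
  have "N < M" using d by (simp add: M_def del: zero_less_divide_1_iff)
  then have M: "N < M" "0 < M" "K\<^sup>2 \<le> M" "1 < M" using N KK unfolding N_def by linarith+
  define \<kappa> where "\<kappa> = N / M"
  have \<kappa>: "0 \<le> \<kappa>" "\<kappa> < 1" using M N by (simp_all add: \<kappa>_def)
  define k where "k t = 1 - (1 / M) *\<^sub>R (adj (f t) * f t)" for t
  define k' where "k' t = - ((1 / M) *\<^sub>R (adj (f t) * f' t + adj (f' t) * f t))" for t
  have nk: "norm (k t) \<le> \<kappa>" if "t \<in> ?I" for t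
    unfolding k_def \<kappa>_def
    by (rule norm_one_minus_adj_mult_less[OF fg[OF that] gf[OF that] K(1,2)[OF that] K1 N_def M_def])
  have dk: "(k has_vector_derivative k' t) (at t within ?I)" if t: "t \<in> ?I" for t
  proof -
    note df = f[OF t]
    have "((\<lambda>t. adj (f t) * f t) has_vector_derivative (adj (f t) * f' t + adj (f' t) * f t)) (at t within ?I)"
      by (rule has_vector_derivative_mult[OF bounded_linear.has_vector_derivative[OF bounded_linear_adj df] df])
    from bounded_linear.has_vector_derivative[OF bounded_linear_scaleR_right[of "1 / M"] this]
    show ?thesis unfolding k_def k'_def
      using has_vector_derivative_diff[OF has_vector_derivative_const[of 1]] by fastforce
  qed
  define L where "L = 2 * (1 / M) * K * K"
  have nk': "norm (k' t) \<le> L" if t: "t \<in> ?I" for t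
  proof -
    have "norm (adj (f t) * f' t + adj (f' t) * f t) \<le> K * K + K * K"
      by (rule order_trans[OF norm_triangle_ineq], rule add_mono; rule order_trans[OF norm_mult_ineq],
          rule mult_mono) (use K[OF t] in \<open>auto simp: norm_adj\<close>)
    then show ?thesis using M by (simp add: k'_def L_def divide_simps)
  qed
  define a where "a n t = Re (\<tau> (k t ^ Suc n)) / Suc n" for n t
  define a' where "a' n t = Re (\<tau> (k t ^ n * k' t))" for n t
  have bl: "bounded_linear (\<lambda>x. Re (\<tau> x))"
    by (rule bounded_linear_compose[OF bounded_linear_Re bounded_linear_tau])
  have da: "(a n has_field_derivative a' n t) (at t within ?I)" if t: "t \<in> ?I" for n t
  proof -
    have "((\<lambda>t. Re (\<tau> (k t ^ Suc n))) has_vector_derivative Re (\<tau> (pow_deriv (k t) (k' t) (Suc n)))) (at t within ?I)"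
      by (rule bounded_linear.has_vector_derivative[OF bl has_vector_derivative_pow[OF dk[OF t]]])
    moreover have "\<tau> (pow_deriv (k t) (k' t) (Suc n)) = of_nat (Suc n) * \<tau> (k t ^ n * k' t)"
      using tau_pow_deriv[of 1 "k t" "k' t" "Suc n"] by (simp del: pow_deriv.simps)
    ultimately have "((\<lambda>t. Re (\<tau> (k t ^ Suc n))) has_field_derivative (Suc n * a' n t)) (at t within ?I)"
      by (simp add: has_real_derivative_iff_has_vector_derivative a'_def del: power_Suc pow_deriv.simps)
    then have "((\<lambda>t. Re (\<tau> (k t ^ Suc n)) / Suc n) has_field_derivative (Suc n * a' n t) / Suc n) (at t within ?I)"
      by (rule DERIV_cdivide)
    then show ?thesis by (simp add: a_def[abs_def] del: power_Suc of_nat_Suc)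
  qed
  have na': "norm (a' n t) \<le> \<kappa> ^ n * L" if t: "t \<in> ?I" for n t
  proof -
    have "norm (k t ^ n) \<le> \<kappa> ^ n"
      by (rule order_trans[OF norm_power_ineq power_mono[OF nk[OF t] norm_ge_zero]])
    then have "norm (k t ^ n * k' t) \<le> \<kappa> ^ n * L"
      by (intro order_trans[OF norm_mult_ineq] mult_mono nk'[OF t]) (use \<kappa> in auto)
    then show ?thesis
      using norm_tau_le[of "k t ^ n * k' t"] abs_Re_le_cmod[of "\<tau> (k t ^ n * k' t)"]
      by (simp add: a'_def)
  qed
  \<comment> \<open>The geometric series sums to \<open>r\<close>, the inverse of
    \<open>adj (f t) * f t / M\<close>. Rotation under the trace turns \<open>r * k' t\<close> into
    minus the logarithmic derivative plus its conjugate.\<close>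
  have a'_sum: "(\<Sum>n. a' n t) = - 2 * Re (\<tau> (g t * f' t))" if t: "t \<in> ?I" for t
  proof -
    have less: "norm (k t) < 1" using nk[OF t] \<kappa> by simp
    define r where "r = M *\<^sub>R (g t * adj (g t))"
    have "(1 - k t) * r = (adj (f t) * (f t * g t)) * adj (g t)"
      using M by (simp add: k_def r_def mult.assoc)
    also have "\<dots> = adj (g t * f t)" by (simp add: fg[OF t] adj_mult)
    finally have "(1 - k t) * r = 1" by (simp add: gf[OF t] adj_one)
    then have "(\<Sum>n. k t ^ n) = r"
      using geometric_series_inverse(2)[OF less] by (metis mult.assoc mult_1 mult_1_right)
    then have "(\<lambda>n. k t ^ n) sums r"
      using summable_sums[OF complete_algebra_summable_geometric[OF less]] by simp
    then have "(\<lambda>n. k t ^ n * k' t) sums (r * k' t)" by (rule sums_mult2)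
    then have "(\<lambda>n. a' n t) sums Re (\<tau> (r * k' t))"
      unfolding a'_def by (rule bounded_linear.sums[OF bl])
    then have "(\<Sum>n. a' n t) = Re (\<tau> (r * k' t))" by (rule sums_unique[symmetric])
    also have "r * k' t = - (g t * (adj (g t) * adj (f t)) * f' t + g t * adj (g t) * adj (f' t) * f t)"
      using M by (simp add: r_def k'_def algebra_simps)
    also have "\<dots> = - (g t * f' t + g t * adj (f' t * g t) * f t)"
      by (simp add: fg[OF t] adj_one adj_mult mult.assoc flip: adj_mult[of "f t" "g t"])
    also have "\<tau> \<dots> = - (\<tau> (g t * f' t) + \<tau> (adj (f' t * g t) * (f t * g t)))"
      using tau_commute[of "g t" "adj (f' t * g t) * f t"] by (simp add: tau_minus tau_diff mult.assoc)
    also have "\<dots> = - (\<tau> (g t * f' t) + cnj (\<tau> (g t * f' t)))"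
      by (simp add: fg[OF t] tau_adj tau_commute[of "f' t"])
    finally show ?thesis by simp
  qed
  have k0: "k 0 = (1 - 1 / M) *\<^sub>R 1" by (simp add: k_def f0 adj_one scaleR_left_diff_distrib)
  have x0: "0 \<le> 1 - 1 / M" "1 - 1 / M < 1" using M by simp_all
  have a0: "(\<lambda>n. a n 0) sums ln M"
    using minus_ln_one_minus_sums[OF x0] M
    by (simp add: a_def k0 tau_scaleR tau_one ln_div scaleR_power del: power_Suc of_nat_Suc)
  have "\<exists>\<Psi>. \<forall>t\<in>?I. (\<lambda>n. a n t) sums \<Psi> t \<and> (\<Psi> has_field_derivative (\<Sum>n. a' n t)) (at t within ?I)"
  proof (rule has_field_derivative_series[OF _ da])
    show "uniform_limit ?I (\<lambda>n t. \<Sum>i<n. a' i t) (\<lambda>t. \<Sum>n. a' n t) sequentially"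
      by (rule Weierstrass_m_test[OF na']) (use \<kappa> in \<open>auto intro!: summable_mult2 summable_geometric\<close>)
    show "0 \<in> ?I" by simp
    show "summable (\<lambda>n. a n 0)" using a0 by (rule sums_summable)
  qed auto
  then obtain \<Psi> where \<Psi>': "\<forall>t\<in>?I. (\<lambda>n. a n t) sums \<Psi> t \<and>
      (\<Psi> has_field_derivative (\<Sum>n. a' n t)) (at t within ?I)" ..
  have \<Psi>: "\<And>t. t \<in> ?I \<Longrightarrow> (\<lambda>n. a n t) sums \<Psi> t"
      "\<And>t. t \<in> ?I \<Longrightarrow> (\<Psi> has_field_derivative - 2 * Re (\<tau> (g t * f' t))) (at t within ?I)"
    using \<Psi>' a'_sum by metis+
  \<comment> \<open>Both \<open>u\<close> and \<open>- \<Psi> / 2\<close> are antiderivatives of the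
    same function, so only the endpoint values of \<open>\<Psi>\<close> matter. At 0 the element
    \<open>k 0\<close> is scalar, and the value is \<open>ln M\<close>.\<close>
  have "((\<lambda>t. u t + \<Psi> t / 2) has_field_derivative 0) (at t within ?I)" if "t \<in> ?I" for t
    using DERIV_add[OF u[OF that] DERIV_cdivide[OF \<Psi>(2)[OF that], of 2]] by simp
  then obtain c where c: "\<And>t. t \<in> ?I \<Longrightarrow> u t + \<Psi> t / 2 = c"
    using has_field_derivative_zero_constant[of ?I "\<lambda>t. u t + \<Psi> t / 2"] by auto
  have "\<Psi> 0 = ln M" using \<Psi>(1)[of 0] a0 sums_unique2 by auto
  define P where "P = (norm (f 1))\<^sup>2"
  have nz: "f 1 \<noteq> 0" using fg[of 1] by auto
  then have P: "0 < P" by (simp add: P_def)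
  have PM: "P \<le> M"
    using power_mono[of "norm (f 1)" K 2] K(1)[of 1] M by (simp add: P_def)
  have x1: "0 \<le> 1 - P / M" "1 - P / M < 1" using M P PM by simp_all
  \<comment> \<open>A termwise comparison of power series, replacing the operator inequality between
    \<open>log (adj f * f)\<close> and the logarithm of the squared norm of
    \<open>f\<close>.\<close>
  have "- ln (1 - (1 - P / M)) \<le> \<Psi> 1"
  proof (rule sums_le[OF _ minus_ln_one_minus_sums[OF x1] \<Psi>(1)])
    show "(1 - P / M) ^ Suc n / real (Suc n) \<le> a n 1" for n
      unfolding a_def k_def P_def
      by (rule divide_right_mono[OF Re_tau_power_one_minus_ge[OF nz]]) (use PM P_def in auto)
  qed simp
  then have "ln M - ln P \<le> \<Psi> 1" using P M by (simp add: ln_div)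
  with c[of 0] c[of 1] \<open>\<Psi> 0 = ln M\<close> have "u 1 - u 0 \<le> ln P / 2" by simp
  also have "ln P / 2 = ln (norm (f 1))"
    using nz by (simp add: P_def ln_realpow)
  finally show ?thesis .
qed

end

section \<open>Boundedness of powers\<close>


lemma scaleC_sum_left: "(\<Sum>i\<in>A. c i) *\<^sub>C x = (\<Sum>i\<in>A. c i *\<^sub>C (x::'a::complex_vector))"
  by (induction A rule: infinite_finite_induct)
    (simp_all add: scaleC_zero_left scaleC_add_left)

lemma scaleC_sum_right: "c *\<^sub>C (\<Sum>i\<in>A. x i) = (\<Sum>i\<in>A. c *\<^sub>C (x i::'a::complex_vector))"
  by (induction A rule: infinite_finite_induct)
    (simp_all add: scaleC_zero_right scaleC_add_right)

lemma sum_powers_mult_one_minus: "(\<Sum>j<n. x ^ j) * (1 - x) = 1 - (x::'a::ring_1) ^ n"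
proof (induction n)
  case (Suc n)
  have "(\<Sum>j<Suc n. x ^ j) * (1 - x) = (\<Sum>j<n. x ^ j) * (1 - x) + (x ^ n - x ^ n * x)"
    by (simp add: distrib_right right_diff_distrib)
  then show ?case by (simp add: Suc power_commutes)
qed simp

lemma bounded_bilinear_scaleC:
  "bounded_bilinear (\<lambda>c (x::'a::complex_banach_algebra_1). c *\<^sub>C x)"
proof
  show "\<exists>K. \<forall>c (x::'a). norm (c *\<^sub>C x) \<le> norm c * norm x * K"
    by (auto simp: norm_scaleC intro!: exI[of _ 1])
qed (simp_all add: scaleC_add_left scaleC_add_right scaleR_scaleC_commute,
    simp add: scaleR_scaleC[where 'a='a] scaleR_conv_of_real scaleC_scaleC mult.commute)

text \<open>Since \<open>\<omega> ^ N = 1\<close>, the product of \<open>1 - z ^ N\<close> with each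
  resolvent is a finite geometric sum. Summation over all roots of unity annihilates every power of
  \<open>z\<close> except the zeroth.\<close>

lemma resolvent_average_over_roots_of_unity:
  fixes z :: "'a::complex_banach_algebra_1"
  defines "\<omega> \<equiv> \<lambda>N k. exp (2 * of_real pi * \<i> * of_nat k / of_nat N)"
  assumes N: "N \<noteq> 0" and W: "\<And>k. k < N \<Longrightarrow> (1 - \<omega> N k *\<^sub>C z) * W k = 1"
  shows "(1 - z ^ N) * (\<Sum>k<N. W k) = real N *\<^sub>R 1"
proof -
  \<comment> \<open>Swapping the indices makes the sum over the roots a geometric sum in the single
    root \<open>\<omega> N j\<close>.\<close>
  have w_pow: "\<omega> N k ^ j = \<omega> N j ^ k" for j k
    by (simp add: \<omega>_def mult_ac flip: exp_of_nat_mult)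
  have wN: "\<omega> N k ^ N = 1" for k
    using N by (simp add: \<omega>_def flip: exp_of_nat_mult) (simp add: mult_ac exp_eq_1 field_simps)
  have "(1 - z ^ N) * W k = (\<Sum>j<N. (\<omega> N j ^ k) *\<^sub>C z ^ j)" if "k < N" for k
  proof -
    have "1 - z ^ N = 1 - (\<omega> N k *\<^sub>C z) ^ N"
      by (simp add: power_scaleC wN scaleC_one)
    also have "\<dots> = (\<Sum>j<N. (\<omega> N k *\<^sub>C z) ^ j) * (1 - \<omega> N k *\<^sub>C z)"
      by (simp add: sum_powers_mult_one_minus)
    finally show ?thesis
      by (simp add: mult.assoc W[OF that] power_scaleC w_pow[of k])
  qed
  then have "(1 - z ^ N) * (\<Sum>k<N. W k) = (\<Sum>k<N. \<Sum>j<N. (\<omega> N j ^ k) *\<^sub>C z ^ j)"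
    by (simp add: sum_distrib_left)
  also have "\<dots> = (\<Sum>j<N. (\<Sum>k<N. \<omega> N j ^ k) *\<^sub>C z ^ j)"
    by (subst sum.swap) (simp add: scaleC_sum_left)
  also have "\<dots> = (\<Sum>j<N. if j = 0 then real N *\<^sub>R 1 else 0)"
  proof (rule sum.cong[OF refl])
    fix j assume j: "j \<in> {..<N}"
    show "(\<Sum>k<N. \<omega> N j ^ k) *\<^sub>C z ^ j = (if j = 0 then real N *\<^sub>R 1 else 0)"
    proof (cases "j = 0")
      case True
      then show ?thesis by (simp add: \<omega>_def scaleR_scaleC)
    next
      case False
      then have "\<not> N dvd j" using j by (auto dest: dvd_imp_le)
      then have "\<omega> N j \<noteq> 1" using complex_root_unity_eq_1[of N j] N by (simp add: \<omega>_def)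
      moreover have "(\<Sum>k<N. \<omega> N j ^ k) * (1 - \<omega> N j) = 0"
        by (simp add: sum_powers_mult_one_minus wN)
      ultimately show ?thesis using False by (simp add: scaleC_zero_left)
    qed
  qed
  also have "\<dots> = real N *\<^sub>R 1" using N by (simp add: sum.delta')
  finally show ?thesis .
qed

text \<open>Rickart's argument: by uniform continuity of the resolvent on the closed disc, its averages
  over the circles of radius \<open>s\<close> and \<open>t\<close> are uniformly close, so that the decay of
  \<open>s ^ N * norm (y ^ N)\<close> entails the boundedness of \<open>t ^ N * norm (y ^ N)\<close>.\<close>

lemma powers_bounded_if_resolvent_on_disc:
  fixes y :: "'a::complex_banach_algebra_1"
  assumes inv: "\<And>\<mu>. cmod \<mu> \<le> 1 \<Longrightarrow> 1 - \<mu> *\<^sub>C y \<in> invertibles"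
  shows "Bseq (\<lambda>N. y ^ N)"
proof -
  have "\<forall>\<mu>\<in>cball 0 1. \<exists>w. (1 - \<mu> *\<^sub>C y) * w = 1 \<and> w * (1 - \<mu> *\<^sub>C y) = 1"
    using inv by (auto simp: invertibles_def)
  then obtain W where W: "\<And>\<mu>. \<mu> \<in> cball 0 1 \<Longrightarrow> (1 - \<mu> *\<^sub>C y) * W \<mu> = 1"
      "\<And>\<mu>. \<mu> \<in> cball 0 1 \<Longrightarrow> W \<mu> * (1 - \<mu> *\<^sub>C y) = 1"
    by metis
  interpret sc: bounded_bilinear "\<lambda>c (x::'a). c *\<^sub>C x" by (rule bounded_bilinear_scaleC)
  have "continuous_on (cball 0 1) (\<lambda>\<mu>. 1 - \<mu> *\<^sub>C y)"
    by (intro continuous_intros sc.continuous_on)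
  then have "continuous_on (cball 0 1) W"
    unfolding continuous_on_eq_continuous_within
    by (auto intro: inverse_continuous[OF _ _ W] simp del: mem_cball)
  then have "uniformly_continuous_on (cball 0 1) W"
    by (rule compact_uniformly_continuous) simp
  then obtain \<delta> where \<delta>: "\<delta> > 0"
      "\<And>\<mu> \<nu>. \<mu> \<in> cball 0 1 \<Longrightarrow> \<nu> \<in> cball 0 1 \<Longrightarrow> dist \<mu> \<nu> < \<delta> \<Longrightarrow> dist (W \<mu>) (W \<nu>) < 1/4"
    unfolding uniformly_continuous_on_def by (metis zero_less_divide_iff zero_less_numeral zero_less_one)
  define \<omega> where "\<omega> N k = exp (2 * of_real pi * \<i> * of_nat k / of_nat N)" for N k :: nat
  have n\<omega>: "cmod (\<omega> N k) = 1" for N k by (simp add: \<omega>_def)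
  define V where "V N t = (1 / real N) *\<^sub>R (\<Sum>k<N. W (\<omega> N k * complex_of_real t))" for N t
  have V: "(1 - t ^ N *\<^sub>R y ^ N) * V N t = 1" if "N \<noteq> 0" "t \<in> {0..1}" for N t
  proof -
    have "(1 - (complex_of_real t *\<^sub>C y) ^ N) * (\<Sum>k<N. W (\<omega> N k * complex_of_real t)) = real N *\<^sub>R 1"
    proof (rule resolvent_average_over_roots_of_unity[OF that(1)])
      fix k
      show "(1 - exp (2 * of_real pi * \<i> * of_nat k / of_nat N) *\<^sub>C complex_of_real t *\<^sub>C y)
          * W (\<omega> N k * complex_of_real t) = 1"
        using W(1)[of "\<omega> N k * complex_of_real t"] that n\<omega>
        by (simp add: \<omega>_def scaleC_scaleC norm_mult)
    qed
    then show ?thesis using that(1)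
      by (simp add: V_def flip: scaleR_scaleC) 
  qed
  have V_close: "norm (V N t - V N s) \<le> 1/4"
    if "N \<noteq> 0" "t \<in> {0..1}" "s \<in> {0..1}" "\<bar>t - s\<bar> < \<delta>" for N t s
  proof -
    have "norm (W (\<omega> N k * complex_of_real t) - W (\<omega> N k * complex_of_real s)) \<le> 1/4" for k
    proof -
      have "dist (\<omega> N k * complex_of_real t) (\<omega> N k * complex_of_real s) = \<bar>t - s\<bar>"
        by (simp add: dist_norm n\<omega> norm_mult flip: right_diff_distrib of_real_diff)
      then show ?thesis
        using \<delta>(2)[of "\<omega> N k * complex_of_real t" "\<omega> N k * complex_of_real s"] that n\<omega>
        by (simp add: norm_mult dist_norm)
    qed
    then have "norm (\<Sum>k<N. W (\<omega> N k * complex_of_real t) - W (\<omega> N k * complex_of_real s)) \<le> real N * (1/4)"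
      using sum_norm_bound[of "{..<N}" "\<lambda>k. W (\<omega> N k * complex_of_real t) - W (\<omega> N k * complex_of_real s)" "1/4"]
      by simp
    moreover have "V N t - V N s =
        (1 / real N) *\<^sub>R (\<Sum>k<N. W (\<omega> N k * complex_of_real t) - W (\<omega> N k * complex_of_real s))"
      by (simp add: V_def sum_subtractf scaleR_diff_right)
    ultimately show ?thesis using that(1) by (simp add: divide_simps mult_ac)
  qed
  \<comment> \<open>With 1/5 one gets \<open>norm (V N s - 1) \<le> 1/4\<close>; the oscillation
    bound 1/4 then gives \<open>norm (1 - V N t) \<le> 1/2\<close>. Hence
    \<open>norm X \<le> (1 + norm X) / 2\<close>, that is, \<open>norm X \<le> 1\<close>.\<close>
  have step: "t ^ N * norm (y ^ N) \<le> 1"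
    if N: "N \<noteq> 0" and ts: "t \<in> {0..1}" "s \<in> {0..1}" "\<bar>t - s\<bar> < \<delta>"
      and small: "s ^ N * norm (y ^ N) \<le> 1/5" for N t s
  proof -
    have "V N s - 1 = (s ^ N *\<^sub>R y ^ N) * V N s"
      using V[OF N ts(2)] by (simp add: algebra_simps)
    then have "norm (V N s - 1) \<le> (s ^ N * norm (y ^ N)) * norm (V N s)"
      using norm_mult_ineq[of "s ^ N *\<^sub>R y ^ N" "V N s"] ts by simp
    also have "\<dots> \<le> (1/5) * norm (V N s)" by (rule mult_right_mono[OF small]) simp
    also have "norm (V N s) \<le> 1 + norm (V N s - 1)"
      using norm_triangle_ineq[of 1 "V N s - 1"] by simp
    finally have "norm (V N s - 1) \<le> 1/4" by simp
    then have V1: "norm (1 - V N t) \<le> 1/2"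
      using V_close[OF N ts] norm_triangle_ineq[of "V N t - V N s" "V N s - 1"]
      by (simp add: norm_minus_commute[of 1])
    define X where "X = t ^ N *\<^sub>R y ^ N"
    have "X = (1 - X) * (V N t - 1)"
      using V[OF N ts(1)] by (simp add: X_def[symmetric] right_diff_distrib)
    then have "norm X \<le> norm (1 - X) * norm (1 - V N t)"
      using norm_mult_ineq[of "1 - X" "V N t - 1"] by (simp add: norm_minus_commute)
    also have "\<dots> \<le> (1 + norm X) * (1/2)"
      using V1 norm_triangle_ineq4[of 1 X] by (intro mult_mono) auto
    finally show ?thesis using ts by (simp add: X_def)
  qed
  \<comment> \<open>The radius grows by a third of \<open>\<delta>\<close> per step. Boundedness at
    \<open>s'\<close>, one third below \<open>t\<close>, yields geometric decay at the smaller
    \<open>s\<close>, two thirds below, and \<open>s\<close> is still within \<open>\<delta>\<close>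
    of \<open>t\<close>.\<close>
  have bseq: "\<forall>t\<in>{0..1}. t \<le> real k * (\<delta> / 3) \<longrightarrow> Bseq (\<lambda>N. t ^ N * norm (y ^ N))" for k
  proof (induction k)
    case 0
    have "Bseq (\<lambda>N. 0 ^ N * norm (y ^ N))"
      by (rule BseqI'[of _ 1]) (simp add: power_0_left)
    then show ?case by auto
  next
    case (Suc k)
    show ?case
    proof (intro ballI impI)
      fix t :: real assume t: "t \<in> {0..1}" "t \<le> real (Suc k) * (\<delta> / 3)"
      define s' where "s' = max 0 (t - \<delta> / 3)"
      define s where "s = max 0 (t - 2 * \<delta> / 3)"
      have s: "s \<in> {0..1}" "\<bar>t - s\<bar> < \<delta>" "0 \<le> s" using t \<delta>(1) by (auto simp: s_def)
      have "0 \<le> real k * (\<delta> / 3)" "t - \<delta> / 3 \<le> real k * (\<delta> / 3)"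
        using t \<delta>(1) by (simp_all add: algebra_simps)
      then have "s' \<le> real k * (\<delta> / 3)" unfolding s'_def by (rule max.boundedI)
      moreover have "s' \<in> {0..1}" using t \<delta>(1) by (auto simp: s'_def)
      ultimately have "Bseq (\<lambda>N. s' ^ N * norm (y ^ N))" using Suc.IH by blast
      then obtain C where C: "\<And>N. s' ^ N * norm (y ^ N) \<le> C"
        unfolding Bseq_def by (metis abs_le_iff real_norm_def)
      have "(\<lambda>N. s ^ N * norm (y ^ N)) \<longlonglongrightarrow> 0"
      proof (cases "s = 0")
        case True
        then have "\<forall>\<^sub>F N in sequentially. s ^ N * norm (y ^ N) = 0"
          by (auto simp: eventually_sequentially power_0_left intro!: exI[of _ 1])
        then show ?thesis by (rule tendsto_eventually)
      next
        case False
        then have ss': "0 < s" "s < s'" "0 < s'" using \<delta>(1) by (auto simp: s_def s'_def max_def split: if_splits)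
        have le: "s ^ N * norm (y ^ N) \<le> (s / s') ^ N * C" for N
        proof -
          have "s ^ N * norm (y ^ N) = (s / s') ^ N * (s' ^ N * norm (y ^ N))"
            using ss' by (simp add: power_divide)
          also have "\<dots> \<le> (s / s') ^ N * C"
            using C ss' by (intro mult_left_mono) auto
          finally show ?thesis .
        qed
        have "(\<lambda>N. (s / s') ^ N) \<longlonglongrightarrow> 0" using ss' by (intro LIMSEQ_power_zero) simp
        then have "(\<lambda>N. (s / s') ^ N * C) \<longlonglongrightarrow> 0" by (rule tendsto_mult_left_zero)
        then show ?thesis
          by (rule tendsto_sandwich[rotated 3, where f="\<lambda>_. 0"]) (use le ss' in \<open>auto intro!: always_eventually\<close>)
      qed
      then have "\<forall>\<^sub>F N in sequentially. s ^ N * norm (y ^ N) < 1/5"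
        by (rule order_tendstoD) simp
      then have "\<forall>\<^sub>F N in sequentially. norm (t ^ N * norm (y ^ N)) \<le> norm (1::real)"
        using eventually_gt_at_top[of 0]
      proof eventually_elim
        case (elim N)
        then show ?case using step[of N t s] t s by simp
      qed
      then show "Bseq (\<lambda>N. t ^ N * norm (y ^ N))"
        by (rule Bseq_eventually_mono) simp
    qed
  qed
  obtain k :: nat where "3 / \<delta> \<le> real k" using real_arch_simple by blast
  then have "1 \<le> real k * (\<delta> / 3)" using \<delta>(1) by (simp add: field_simps)
  then have "Bseq (\<lambda>N. 1 ^ N * norm (y ^ N))" using bseq[of k] by (metis atLeastAtMost_iff order_refl zero_le_one)
  then show ?thesis by (simp add: Bseq_def)
qed

section \<open>Complex curves of invertible elements\<close>


text \<open>Holomorphy of algebra-valued functions, phrased as a Frechet derivative of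
  complex-linear form so that the product and inverse rules carry over.\<close>

definition has_cderiv :: "(complex \<Rightarrow> 'a::complex_banach_algebra_1) \<Rightarrow> 'a \<Rightarrow> complex \<Rightarrow> bool"
  where "has_cderiv f f' z \<longleftrightarrow> (f has_derivative (\<lambda>h. h *\<^sub>C f')) (at z)"

lemma has_cderiv_mult:
  assumes "has_cderiv f f' z" "has_cderiv g g' z"
  shows "has_cderiv (\<lambda>z. f z * g z) (f' * g z + f z * g') z"
  using has_derivative_mult[OF assms[unfolded has_cderiv_def]]
  by (simp add: has_cderiv_def mult_scaleC_left mult_scaleC_right scaleC_add_right add.commute)

lemma has_cderiv_diff:
  assumes "has_cderiv f f' z" "has_cderiv g g' z"
  shows "has_cderiv (\<lambda>z. f z - g z) (f' - g') z"
  using has_derivative_diff[OF assms[unfolded has_cderiv_def]]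
  by (simp add: has_cderiv_def scaleC_diff_right)

lemma has_cderiv_sum:
  assumes "\<And>i. i \<in> A \<Longrightarrow> has_cderiv (f i) (f' i) z"
  shows "has_cderiv (\<lambda>z. \<Sum>i\<in>A. f i z) (\<Sum>i\<in>A. f' i) z"
  using has_derivative_sum[of A f "\<lambda>i h. h *\<^sub>C f' i" "at z"] assms
  by (simp add: has_cderiv_def scaleC_sum_right)

lemma has_cderiv_scaleC:
  assumes "(\<phi> has_field_derivative d) (at z)"
  shows "has_cderiv (\<lambda>z. \<phi> z *\<^sub>C x) (d *\<^sub>C x) z"
  using bounded_linear.has_derivative[OF bounded_bilinear.bounded_linear_left[OF bounded_bilinear_scaleC]
      assms[unfolded has_field_derivative_def], of x]
  by (simp add: has_cderiv_def scaleC_scaleC mult.commute)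

lemma has_cderiv_inverse:
  assumes "open S" "z \<in> S" and f: "has_cderiv f f' z"
    and inv: "\<And>w. w \<in> S \<Longrightarrow> f w * g w = 1" "\<And>w. w \<in> S \<Longrightarrow> g w * f w = 1"
  shows "has_cderiv g (- (g z * f' * g z)) z"
proof -
  have "(f has_derivative (\<lambda>h. h *\<^sub>C f')) (at z within S)"
    using f by (simp add: has_cderiv_def has_derivative_at_withinI)
  from has_derivative_inverse_mult[OF \<open>z \<in> S\<close> this inv]
  have "(g has_derivative (\<lambda>h. - (g z * (h *\<^sub>C f') * g z))) (at z)"
    by (simp only: at_within_open[OF assms(2,1)])
  then show ?thesis
    by (simp add: has_cderiv_def mult_scaleC_left mult_scaleC_right scaleC_minus_right)
qed

lemma has_cderiv_continuous: "has_cderiv f f' z \<Longrightarrow> continuous (at z) f"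
  unfolding has_cderiv_def by (rule has_derivative_continuous)

lemma has_cderiv_along_ray:
  assumes "has_cderiv f f' (of_real t * \<mu>)"
  shows "((\<lambda>t. f (of_real t * \<mu>)) has_vector_derivative (\<mu> *\<^sub>C f')) (at t within S)"
proof -
  have "((\<lambda>t. of_real t * \<mu>) has_derivative (\<lambda>h. of_real h * \<mu>)) (at t within S)"
    by (intro bounded_linear_imp_has_derivative
        bounded_linear_compose[OF bounded_linear_mult_left bounded_linear_of_real])
  from has_derivative_compose[OF this assms[unfolded has_cderiv_def]] show ?thesis
    by (simp add: has_vector_derivative_def scaleR_scaleC scaleC_scaleC)
qed

text \<open>The map sending \<open>w\<close> to \<open>w / (2 K - w)\<close> takes the half plane
  \<open>Re w < K\<close> into the unit disc and fixes 0. The Schwarz lemma bounds its composite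
  with \<open>G\<close> by 1/2 at half the radius.\<close>

lemma Borel_Caratheodory_half:
  assumes holG: "G holomorphic_on ball 0 \<rho>" and G0: "G 0 = 0" and \<rho>: "0 < \<rho>"
    and K: "\<And>z. z \<in> ball 0 \<rho> \<Longrightarrow> Re (G z) < K"
    and z: "cmod z \<le> \<rho> / 2"
  shows "cmod (G z) \<le> 2 * K"
proof -
  have K0: "0 < K" using K[of 0] G0 \<rho> by simp
  define f where "f w = G (\<rho> * w) / (2 * K - G (\<rho> * w))" for w :: complex
  have mem: "\<rho> * w \<in> ball 0 \<rho>" if "cmod w < 1" for w :: complex
    using that \<rho> by (simp add: norm_mult)
  have nz: "2 * K - G (\<rho> * w) \<noteq> 0" if "cmod w < 1" for w :: complex
    using K[OF mem[OF that]] K0 by (auto simp: complex_eq_iff)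
  have holc: "(\<lambda>w. G (\<rho> * w)) holomorphic_on ball 0 1"
    by (rule holomorphic_on_compose_gen[OF _ holG, unfolded o_def])
      (use mem in \<open>auto intro!: holomorphic_intros\<close>)
  have hol: "f holomorphic_on ball 0 1"
    unfolding f_def by (intro holomorphic_intros holc) (use nz in auto)
  have less: "cmod (f w) < 1" if "cmod w < 1" for w :: complex
  proof -
    let ?g = "G (\<rho> * w)"
    have "(cmod ?g)\<^sup>2 < (cmod (2 * K - ?g))\<^sup>2"
      using mult_strict_left_mono[OF K[OF mem[OF that]] K0]
      unfolding cmod_power2 by (simp add: power2_eq_square algebra_simps)
    then have "cmod ?g < cmod (2 * K - ?g)" by (rule power2_less_imp_less) simp
    then show ?thesis using nz[OF that] by (simp add: f_def norm_divide)
  qed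
  define w where "w = z / \<rho>"
  have w: "cmod w \<le> 1/2" using z \<rho> by (simp add: w_def norm_divide)
  have "cmod (f w) \<le> cmod w"
    by (rule Schwarz_Lemma(1)[OF hol _ less]) (use w G0 in \<open>auto simp: f_def\<close>)
  then have "cmod (f w) \<le> 1/2" using w by simp
  moreover have zw: "\<rho> * w = z" using \<rho> by (simp add: w_def)
  ultimately have "cmod (G z) / cmod (2 * K - G z) \<le> 1/2"
    by (simp add: f_def norm_divide)
  moreover have "0 < cmod (2 * K - G z)" using nz[of w] w by (simp add: zw)
  ultimately have "cmod (G z) \<le> 1/2 * cmod (2 * K - G z)"
    by (simp only: pos_divide_le_eq)
  also have "cmod (2 * K - G z) \<le> 2 * K + cmod (G z)"
    using norm_triangle_ineq4[of "2 * complex_of_real K" "G z"] K0 by simp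
  finally show ?thesis by simp
qed

lemma continuous_on_pow_deriv:
  fixes f d :: "'c::topological_space \<Rightarrow> 'a::real_normed_algebra_1"
  assumes "continuous_on S f" "continuous_on S d"
  shows "continuous_on S (\<lambda>t. pow_deriv (f t) (d t) n)"
  by (induction n) (auto intro!: continuous_intros assms)

context finite_cstar
begin

lemma has_cderiv_tau:
  assumes "has_cderiv f f' z"
  shows "((\<lambda>z. \<tau> (f z)) has_field_derivative \<tau> f') (at z)"
  using bounded_linear.has_derivative[OF bounded_linear_tau assms[unfolded has_cderiv_def]]
  by (simp add: has_field_derivative_def tau_scaleC mult_commute_abs)

text \<open>Along the ray to \<open>\<mu>\<close>, the curve \<open>F ^ m\<close> has
  \<open>m\<close> times the logarithmic derivative of \<open>F\<close> under the trace. So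
  \<open>m * Re (G \<mu>)\<close> is at most \<open>ln C + m * ln R\<close>; the limit in
  \<open>m\<close> discards \<open>C\<close>, which may depend on \<open>\<mu>\<close>.\<close>

lemma Re_log_det_le:
  fixes F F' g :: "complex \<Rightarrow> 'a"
  assumes F0: "F 0 = 1"
    and F: "\<And>z. z \<in> ball 0 \<rho> \<Longrightarrow> has_cderiv F (F' z) z"
    and F': "continuous_on (ball 0 \<rho>) F'"
    and inv: "\<And>z. z \<in> ball 0 \<rho> \<Longrightarrow> F z * g z = 1" "\<And>z. z \<in> ball 0 \<rho> \<Longrightarrow> g z * F z = 1"
    and G: "\<And>z. z \<in> ball 0 \<rho> \<Longrightarrow> (G has_field_derivative \<tau> (g z * F' z)) (at z)" and G0: "G 0 = 0"
    and R: "0 < R" and bound: "\<And>m. norm (F \<mu> ^ m) \<le> C * R ^ m" and \<mu>: "\<mu> \<in> ball 0 \<rho>"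
  shows "Re (G \<mu>) \<le> ln R"
proof -
  have C: "1 \<le> C" using bound[of 0] by simp
  have mem: "of_real t * \<mu> \<in> ball 0 \<rho>" if "t \<in> {0..1}" for t
  proof -
    have "t * cmod \<mu> \<le> 1 * cmod \<mu>" using that by (intro mult_right_mono) auto
    then show ?thesis using that \<mu> by (simp add: norm_mult)
  qed
  have ray: "continuous_on {0..1} (\<lambda>t. h (of_real t * \<mu>))" if "continuous_on (ball 0 \<rho>) h"
    for h :: "complex \<Rightarrow> 'a"
    by (rule continuous_on_compose2[OF that]) (use mem in \<open>auto intro!: continuous_intros\<close>)
  have cF: "continuous_on (ball 0 \<rho>) F"
    by (intro continuous_at_imp_continuous_on ballI has_cderiv_continuous[OF F])
  interpret sc: bounded_bilinear "\<lambda>c (x::'a). c *\<^sub>C x" by (rule bounded_bilinear_scaleC)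
  have le: "real m * Re (G \<mu>) \<le> ln (norm (F \<mu> ^ m))" for m
  proof -
    let ?d = "\<lambda>t. pow_deriv (F (of_real t * \<mu>)) (\<mu> *\<^sub>C F' (of_real t * \<mu>)) m"
    have "(\<lambda>t. real m * Re (G (of_real t * \<mu>))) 1 - (\<lambda>t. real m * Re (G (of_real t * \<mu>))) 0
        \<le> ln (norm ((\<lambda>t. F (of_real t * \<mu>) ^ m) 1))"
    proof (rule Re_tau_logarithmic_derivative_le[where f' = ?d and g = "\<lambda>t. g (of_real t * \<mu>) ^ m"])
      fix t :: real assume t: "t \<in> {0..1}"
      let ?z = "of_real t * \<mu>"
      show "((\<lambda>t. F (of_real t * \<mu>) ^ m) has_vector_derivative ?d t) (at t within {0..1})"
        by (rule has_vector_derivative_pow[OF has_cderiv_along_ray[OF F[OF mem[OF t]]]])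
      show "F ?z ^ m * g ?z ^ m = 1" "g ?z ^ m * F ?z ^ m = 1"
        using inv[OF mem[OF t]] by (simp_all add: left_right_inverse_power)
      have "g ?z * F ?z = F ?z * g ?z" using inv[OF mem[OF t]] by simp
      then have "g ?z ^ m * F ?z = F ?z * g ?z ^ m" by (rule power_commuting_commutes)
      then have "\<tau> (g ?z ^ m * ?d t) = of_nat m * \<tau> (g ?z ^ m * F ?z ^ (m - 1) * (\<mu> *\<^sub>C F' ?z))"
        by (rule tau_pow_deriv)
      also have "\<dots> = of_nat m * (\<mu> * \<tau> (g ?z * F' ?z))"
      proof (cases m)
        case (Suc n)
        have "g ?z ^ m * F ?z ^ (m - 1) = g ?z"
          using inv[OF mem[OF t]] by (simp add: Suc mult.assoc left_right_inverse_power)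
        then show ?thesis by (simp add: mult_scaleC_right tau_scaleC)
      qed simp
      finally have eq: "\<tau> (g ?z ^ m * ?d t) = of_nat m * (\<mu> * \<tau> (g ?z * F' ?z))" .
      have "((\<lambda>t. of_real t * \<mu>) has_vector_derivative \<mu>) (at t)"
        unfolding has_vector_derivative_def
        using bounded_linear_imp_has_derivative[OF bounded_linear_compose[OF
            bounded_linear_mult_left bounded_linear_of_real]]
        by (simp add: scaleR_conv_of_real)
      from field_vector_diff_chain_at[OF this G[OF mem[OF t]]]
      have "((\<lambda>t. G (of_real t * \<mu>)) has_vector_derivative \<mu> * \<tau> (g ?z * F' ?z)) (at t within {0..1})"
        by (simp add: o_def has_vector_derivative_at_within)
      from bounded_linear.has_vector_derivative[OF bounded_linear_Re this]
      have "((\<lambda>t. Re (G (of_real t * \<mu>))) has_field_derivative Re (\<mu> * \<tau> (g ?z * F' ?z))) (at t within {0..1})"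
        by (simp add: has_real_derivative_iff_has_vector_derivative)
      from DERIV_cmult[OF this, of "real m"]
      show "((\<lambda>t. real m * Re (G (of_real t * \<mu>))) has_real_derivative Re (\<tau> (g ?z ^ m * ?d t))) (at t within {0..1})"
        unfolding eq by simp
    next
      show "continuous_on {0..1} ?d"
        by (intro continuous_on_pow_deriv ray cF sc.continuous_on continuous_on_const F')
    qed (simp add: F0)
    then show ?thesis by (simp add: G0)
  qed
  have le': "Re (G \<mu>) - ln R \<le> ln C / real m" if m: "m > 0" for m
  proof -
    have "F \<mu> ^ m * g \<mu> ^ m = 1" using inv[OF \<mu>] by (simp add: left_right_inverse_power)
    then have "0 < norm (F \<mu> ^ m)" by auto
    then have "ln (norm (F \<mu> ^ m)) \<le> ln (C * R ^ m)" by (intro ln_mono[OF bound])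
    also have "\<dots> = ln C + real m * ln R" using C R by (simp add: ln_mult ln_realpow)
    finally show ?thesis using le[of m] m by (simp add: field_simps)
  qed
  have "(\<lambda>m. ln C / real m) \<longlonglongrightarrow> 0" by real_asymp
  then have "Re (G \<mu>) - ln R \<le> 0"
    by (rule tendsto_lowerbound) (auto intro!: eventually_mono[OF eventually_gt_at_top[of 0]] le')
  then show ?thesis by simp
qed

end

section \<open>Taylor coefficients of the logarithm of the determinant\<close>


lemma real_choose_two: "real (n choose 2) = real n * (real n - 1) / 2"
  by (induction n) (simp_all add: numeral_2_eq_2 field_simps)

lemma real_choose_three: "real (n choose 3) = real n * (real n - 1) * (real n - 2) / 6"
proof (induction n)
  case (Suc n)
  have "Suc n choose 3 = (n choose 2) + (n choose 3)"
    by (simp add: numeral_3_eq_3 numeral_2_eq_2)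
  then show ?case by (simp add: Suc real_choose_two field_simps)
qed simp

lemma one_plus_power_binomial:
  fixes x :: "'a::real_algebra_1"
  shows "(1 + x) ^ n = (\<Sum>i\<le>n. real (n choose i) *\<^sub>R x ^ i)"
proof (induction n)
  case (Suc n)
  let ?S = "\<Sum>i\<le>n. real (n choose i) *\<^sub>R x ^ i"
  have "?S = (\<Sum>i\<le>Suc n. real (n choose i) *\<^sub>R x ^ i)" by simp
  also have "\<dots> = 1 + (\<Sum>i\<le>n. real (n choose Suc i) *\<^sub>R x ^ Suc i)"
    by (subst sum.atMost_Suc_shift) simp
  finally have S: "?S = 1 + (\<Sum>i\<le>n. real (n choose Suc i) *\<^sub>R x ^ Suc i)" .
  have "(1 + x) ^ Suc n = ?S + x * ?S" by (simp add: Suc distrib_right)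
  also have "x * ?S = (\<Sum>i\<le>n. real (n choose i) *\<^sub>R x ^ Suc i)"
    by (simp add: sum_distrib_left)
  also have "?S + \<dots> = 1 + (\<Sum>i\<le>n. real (Suc n choose Suc i) *\<^sub>R x ^ Suc i)"
    by (subst S) (simp add: scaleR_left_distrib sum.distrib add.commute)
  also have "\<dots> = (\<Sum>i\<le>Suc n. real (Suc n choose i) *\<^sub>R x ^ i)"
    by (subst sum.atMost_Suc_shift) simp
  finally show ?case .
qed simp

definition binomial_product_coeff :: "nat \<Rightarrow> 'a \<Rightarrow> 'a \<Rightarrow> nat \<Rightarrow> 'a::real_algebra_1" where
  "binomial_product_coeff n a b j =
    (\<Sum>i\<le>j. (real (n choose i) * real (n choose (j - i))) *\<^sub>R (a ^ i * b ^ (j - i)))"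

text \<open>Proved as a Cauchy product of two finitely supported series. The bound \<open>N\<close>
  is left free so that coefficients up to the third are available even for small
  \<open>n\<close>.\<close>

lemma binomial_product_expansion:
  fixes a b :: "'a::complex_banach_algebra_1"
  assumes N: "2 * n \<le> N"
  shows "(1 + z *\<^sub>C a) ^ n * (1 + z *\<^sub>C b) ^ n = (\<Sum>j\<le>N. z ^ j *\<^sub>C binomial_product_coeff n a b j)"
proof -
  define x where "x c i = real (n choose i) *\<^sub>R (z *\<^sub>C c) ^ i" for c :: 'a and i
  have x0: "x c i = 0" if "i \<notin> {..n}" for c i using that by (simp add: x_def)
  have s: "summable (\<lambda>i. norm (x c i))" for c
    by (rule summable_finite[of "{..n}"]) (use x0 in auto)
  have sx: "suminf (x c) = (1 + z *\<^sub>C c) ^ n" for c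
    using suminf_finite[of "{..n}" "x c"] x0 by (simp add: one_plus_power_binomial x_def)
  have coeff: "(\<Sum>i\<le>j. x a i * x b (j - i)) = z ^ j *\<^sub>C binomial_product_coeff n a b j" for j
    unfolding binomial_product_coeff_def scaleC_sum_right
  proof (rule sum.cong[OF refl])
    fix i assume "i \<in> {..j}"
    then have "z ^ i * z ^ (j - i) = z ^ j" by (simp flip: power_add)
    then show "x a i * x b (j - i) =
        z ^ j *\<^sub>C (real (n choose i) * real (n choose (j - i))) *\<^sub>R (a ^ i * b ^ (j - i))"
      by (simp add: x_def power_scaleC mult_scaleC_left mult_scaleC_right scaleC_scaleC
          scaleR_scaleC_commute mult.commute)
  qed
  have "(1 + z *\<^sub>C a) ^ n * (1 + z *\<^sub>C b) ^ n = (\<Sum>j. \<Sum>i\<le>j. x a i * x b (j - i))"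
    using Cauchy_product[OF s s, of a b] by (simp add: sx)
  also have "\<dots> = (\<Sum>j\<le>N. \<Sum>i\<le>j. x a i * x b (j - i))"
  proof (rule suminf_finite)
    fix j assume j: "j \<notin> {..N}"
    show "(\<Sum>i\<le>j. x a i * x b (j - i)) = 0"
    proof (rule sum.neutral, rule ballI)
      fix i
      have "i \<notin> {..n} \<or> j - i \<notin> {..n}" using j N by auto
      then show "x a i * x b (j - i) = 0" using x0 by auto
    qed
  qed simp
  finally show ?thesis by (simp add: coeff)
qed

lemma binomial_product_coeff_low:
  fixes a b :: "'a::real_algebra_1"
  shows "binomial_product_coeff n a b 0 = 1"
    and "binomial_product_coeff n a b 1 = real n *\<^sub>R (a + b)"
    and "binomial_product_coeff n a b 2 =
      real (n choose 2) *\<^sub>R (a * a + b * b) + (real n * real n) *\<^sub>R (a * b)"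
    and "binomial_product_coeff n a 0 3 = real (n choose 3) *\<^sub>R (a * a * a)"
  by (simp_all add: binomial_product_coeff_def numeral_2_eq_2 numeral_3_eq_3 scaleR_right_distrib
      mult.assoc)

text \<open>The \<open>r\<close>-th derivative of the polynomial with coefficients \<open>c\<close>; for \<open>j < r\<close> the product
  contains the factor \<open>j - j\<close>, so that the truncated exponent is harmless.\<close>

definition poly_deriv :: "nat \<Rightarrow> (nat \<Rightarrow> 'a) \<Rightarrow> nat \<Rightarrow> complex \<Rightarrow> 'a::complex_banach_algebra_1" where
  "poly_deriv N c r z = (\<Sum>j\<le>N. (of_nat (\<Prod>i<r. j - i) * z ^ (j - r)) *\<^sub>C c j)"

lemma has_cderiv_poly_deriv: "has_cderiv (poly_deriv N c r) (poly_deriv N c (Suc r) z) z"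
proof -
  have "((\<lambda>z. of_nat (\<Prod>i<r. j - i) * z ^ (j - r)) has_field_derivative
      of_nat (\<Prod>i<Suc r. j - i) * z ^ (j - Suc r)) (at z)" for j
    by (auto intro!: derivative_eq_intros)
  then show ?thesis
    unfolding poly_deriv_def[abs_def] by (intro has_cderiv_sum has_cderiv_scaleC)
qed

lemma poly_deriv_at_0:
  assumes "r \<le> N"
  shows "poly_deriv N c r 0 = fact r *\<^sub>R c r"
proof -
  have "(of_nat (\<Prod>i<r. j - i) * 0 ^ (j - r)) *\<^sub>C c j = (if j = r then fact r *\<^sub>R c r else 0)" for j
  proof (cases j r rule: linorder_cases)
    case less
    then have z: "(\<Prod>i<r. j - i) = 0" by (intro prod_zero) auto
    show ?thesis unfolding z using less by (simp add: scaleC_zero_left)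
  next
    case equal
    have "(\<Prod>i<r. r - i) = fact r" by (simp add: fact_prod_rev atLeast0LessThan)
    then show ?thesis using equal by (simp add: scaleR_scaleC del: of_nat_prod)
  qed (simp add: scaleC_zero_left power_0_left)
  then show ?thesis using assms by (simp add: poly_deriv_def)
qed

lemma leading_coefficient_zero_if_growth_less:
  fixes X Y Z :: complex
  assumes "\<And>n. n \<ge> 1 \<Longrightarrow> cmod (X * of_nat n ^ 3 + Y * of_nat n ^ 2 + Z * of_nat n) \<le> B * real n ^ 2"
  shows "X = 0"
proof (rule ccontr)
  assume "X \<noteq> 0"
  then obtain n :: nat where n: "(B + cmod Y + cmod Z) / cmod X < real n"
    using reals_Archimedean2 by blast
  define m where "m = Suc n"
  have m: "B + cmod Y + cmod Z < cmod X * real m" "m \<ge> 1"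
    using n \<open>X \<noteq> 0\<close> by (simp_all add: m_def field_simps)
      (metis add.commute add_strict_increasing2 mult.commute norm_ge_zero zero_less_norm_iff less_imp_le add_less_le_mono add.right_neutral)
  have "cmod X * real m ^ 3 = cmod ((X * of_nat m ^ 3 + Y * of_nat m ^ 2 + Z * of_nat m)
      - Y * of_nat m ^ 2 - Z * of_nat m)"
    by (simp add: norm_mult norm_power)
  also have "\<dots> \<le> B * real m ^ 2 + cmod Y * real m ^ 2 + cmod Z * real m"
    using assms[OF m(2)]
    by (intro order_trans[OF norm_triangle_ineq4] add_mono) (simp_all add: norm_mult norm_power)
  also have "cmod Z * real m \<le> cmod Z * real m ^ 2"
    using m(2) by (intro mult_left_mono) (simp_all add: power2_eq_square)
  finally have "(cmod X * real m) * real m ^ 2 \<le> (B + cmod Y + cmod Z) * real m ^ 2"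
    by (simp add: algebra_simps power3_eq_cube power2_eq_square)
  then show False using m by simp
qed

context finite_cstar
begin

text \<open>The two traces are the second and third derivatives at 0 of \<open>G\<close>, the
  logarithm of the determinant of \<open>F\<close>. Borel-Caratheodory bounds \<open>G\<close> by
  \<open>4 * ln R\<close> on the disc of half radius, and Cauchy's inequality bounds its
  derivatives.\<close>

lemma log_det_coefficients_bound:
  fixes c :: "nat \<Rightarrow> 'a"
  assumes \<rho>: "0 < \<rho>" and R: "1 < R" and N: "3 \<le> N" and c0: "c 0 = 1"
    and F: "\<And>z. F z = (\<Sum>j\<le>N. z ^ j *\<^sub>C c j)"
    and inv: "\<And>z. z \<in> ball 0 \<rho> \<Longrightarrow> F z \<in> invertibles"
    and bound: "\<And>z. z \<in> ball 0 \<rho> \<Longrightarrow> \<exists>C. \<forall>m. norm (F z ^ m) \<le> C * R ^ m"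
  shows "cmod (\<tau> (2 *\<^sub>R c 2 - c 1 * c 1)) \<le> 2 * (4 * ln R) / (\<rho> / 2) ^ 2"
    and "cmod (\<tau> (6 *\<^sub>R c 3 - 6 *\<^sub>R (c 1 * c 2) + 2 *\<^sub>R (c 1 * c 1 * c 1)))
      \<le> 6 * (4 * ln R) / (\<rho> / 2) ^ 3"
proof -
  let ?B = "ball (0::complex) \<rho>"
  let ?P = "poly_deriv N c"
  have FP: "F = ?P 0" by (simp add: F poly_deriv_def fun_eq_iff)
  have "\<forall>z\<in>?B. \<exists>w. F z * w = 1 \<and> w * F z = 1" using inv by (auto simp: invertibles_def)
  then obtain g where g: "\<And>z. z \<in> ?B \<Longrightarrow> ?P 0 z * g z = 1" "\<And>z. z \<in> ?B \<Longrightarrow> g z * ?P 0 z = 1"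
    unfolding FP by metis
  have dg: "has_cderiv g (- (g z * ?P 1 z * g z)) z" if "z \<in> ?B" for z
    using has_cderiv_inverse[OF open_ball that has_cderiv_poly_deriv g] by simp
  \<comment> \<open>With the inverse on the right, the derivative of \<open>X\<close> is
    \<open>Y - X * X\<close>; the order against \<open>g z * ?P 1 z\<close> is immaterial under the
    trace.\<close>
  define X where "X z = ?P 1 z * g z" for z
  define Y where "Y z = ?P 2 z * g z" for z
  have dX: "has_cderiv X (Y z - X z * X z) z" if "z \<in> ?B" for z
    using has_cderiv_mult[OF has_cderiv_poly_deriv[of N c 1] dg[OF that]]
    by (simp add: X_def[abs_def] Y_def mult.assoc numeral_2_eq_2)
  have dY: "has_cderiv Y (?P 3 z * g z - Y z * X z) z" if "z \<in> ?B" for z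
    using has_cderiv_mult[OF has_cderiv_poly_deriv[of N c 2] dg[OF that]]
    by (simp add: X_def Y_def[abs_def] mult.assoc numeral_3_eq_3 numeral_2_eq_2)
  define h where "h z = \<tau> (X z)" for z
  define h1 where "h1 z = \<tau> (Y z - X z * X z)" for z
  define h2 where "h2 z = \<tau> (?P 3 z * g z - Y z * X z
      - ((Y z - X z * X z) * X z + X z * (Y z - X z * X z)))" for z
  have dh: "(h has_field_derivative h1 z) (at z)" if "z \<in> ?B" for z
    unfolding h_def h1_def by (rule has_cderiv_tau[OF dX[OF that]])
  have dh1: "(h1 has_field_derivative h2 z) (at z)" if "z \<in> ?B" for z
    unfolding h1_def h2_def
    by (intro has_cderiv_tau has_cderiv_diff has_cderiv_mult dX dY that)
  have "h holomorphic_on ?B"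
    unfolding holomorphic_on_open[OF open_ball] using dh by blast
  then obtain G1 where G1: "\<And>z. z \<in> ?B \<Longrightarrow> (G1 has_field_derivative h z) (at z within ?B)"
    using holomorphic_convex_primitive'[of ?B h] by auto
  define G where "G z = G1 z - G1 0" for z
  have dG: "(G has_field_derivative h z) (at z)" if "z \<in> ?B" for z
    using DERIV_diff[OF G1[OF that] DERIV_const[of "G1 0"]] that
    by (simp add: G_def[abs_def] at_within_open[OF that open_ball])
  have G0: "G 0 = 0" by (simp add: G_def)
  have holG: "G holomorphic_on ?B"
    unfolding holomorphic_on_open[OF open_ball] using dG by blast
  \<comment> \<open>The factor 2 provides the strict inequality that Borel-Caratheodory
    requires.\<close>
  have ReG: "Re (G z) < 2 * ln R" if z: "z \<in> ?B" for z
  proof -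
    obtain C where C: "\<And>m. norm (?P 0 z ^ m) \<le> C * R ^ m" using bound[OF z] FP by auto
    have "Re (G z) \<le> ln R"
    proof (rule Re_log_det_le[where F="?P 0" and F'="?P 1" and g=g and G=G, OF _ _ _ g _ G0 _ C z])
      show "?P 0 0 = 1" using poly_deriv_at_0[of 0 N c] c0 by simp
      show "has_cderiv (?P 0) (?P 1 w) w" for w
        using has_cderiv_poly_deriv[of N c 0] by simp
      show "continuous_on ?B (?P 1)"
        by (intro continuous_at_imp_continuous_on ballI has_cderiv_continuous[OF has_cderiv_poly_deriv])
      show "(G has_field_derivative \<tau> (g w * ?P 1 w)) (at w)" if "w \<in> ?B" for w
        using dG[OF that] by (simp add: h_def X_def tau_commute)
    qed (use R in auto)
    also have "ln R < 2 * ln R" using R by simp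
    finally show ?thesis .
  qed
  have Cauchy: "cmod ((deriv ^^ k) G 0) \<le> fact k * (4 * ln R) / (\<rho> / 2) ^ k" for k
  proof (rule Cauchy_inequality)
    show "G holomorphic_on ball 0 (\<rho> / 2)" by (rule holomorphic_on_subset[OF holG]) (use \<rho> in auto)
    show "continuous_on (cball 0 (\<rho> / 2)) G"
      by (rule continuous_on_subset[OF holomorphic_on_imp_continuous_on[OF holG]]) (use \<rho> in auto)
    show "cmod (G z) \<le> 4 * ln R" if "cmod (0 - z) = \<rho> / 2" for z
      using Borel_Caratheodory_half[OF holG G0 \<rho> ReG, of z] that by simp
  qed (use \<rho> in auto)
  have ev: "\<forall>\<^sub>F z in nhds 0. z \<in> ?B" using \<rho> by (intro eventually_nhds_in_open) auto
  have 0: "0 \<in> ?B" using \<rho> by simp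
  have D1: "\<forall>\<^sub>F z in nhds 0. deriv G z = h z"
    by (rule eventually_mono[OF ev]) (rule DERIV_imp_deriv[OF dG])
  have D2: "\<forall>\<^sub>F z in nhds 0. deriv (deriv G) z = h1 z"
  proof -
    have "deriv (deriv G) z = h1 z" if z: "z \<in> ?B" for z
    proof -
      have "\<forall>\<^sub>F w in nhds z. w \<in> ?B" using z by (intro eventually_nhds_in_open) auto
      then have "\<forall>\<^sub>F w in nhds z. deriv G w = h w"
        by (rule eventually_mono) (rule DERIV_imp_deriv[OF dG])
      then have "deriv (deriv G) z = deriv h z" by (intro deriv_cong_ev) auto
      also have "\<dots> = h1 z" by (rule DERIV_imp_deriv[OF dh[OF z]])
      finally show ?thesis .
    qed
    then show ?thesis by (intro eventually_mono[OF ev])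
  qed
  have D3: "deriv (deriv (deriv G)) 0 = h2 0"
    using deriv_cong_ev[OF D2 refl] DERIV_imp_deriv[OF dh1[OF 0]] by simp
  have g0: "g 0 = 1" using g(1)[OF 0] poly_deriv_at_0[of 0 N c] c0 by simp
  have X0: "X 0 = c 1" using poly_deriv_at_0[of 1 N c] N g0 by (simp add: X_def)
  have Y0: "Y 0 = 2 *\<^sub>R c 2" using poly_deriv_at_0[of 2 N c] N g0 by (simp add: Y_def)
  have P3: "?P 3 0 = 6 *\<^sub>R c 3" using poly_deriv_at_0[of 3 N c] N by (simp add: fact_numeral)
  have "(deriv ^^ 2) G 0 = h1 0"
    using eventually_nhds_x_imp_x[OF D2] by (simp add: numeral_2_eq_2)
  then show "cmod (\<tau> (2 *\<^sub>R c 2 - c 1 * c 1)) \<le> 2 * (4 * ln R) / (\<rho> / 2) ^ 2"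
    using Cauchy[of 2] by (simp add: h1_def X0 Y0)
  have "(deriv ^^ 3) G 0 = h2 0" using D3 by (simp add: numeral_3_eq_3)
  also have "h2 0 = \<tau> (6 *\<^sub>R c 3 - 6 *\<^sub>R (c 1 * c 2) + 2 *\<^sub>R (c 1 * c 1 * c 1))"
    using tau_commute[of "c 2" "c 1"]
    by (simp add: h2_def X0 Y0 P3 g0 tau_diff tau_add tau_scaleR
        scaleR_conv_of_real[where 'a=complex] algebra_simps)
  finally show "cmod (\<tau> (6 *\<^sub>R c 3 - 6 *\<^sub>R (c 1 * c 2) + 2 *\<^sub>R (c 1 * c 1 * c 1)))
      \<le> 6 * (4 * ln R) / (\<rho> / 2) ^ 3"
    using Cauchy[of 3] by (simp add: fact_numeral)
qed

end

section \<open>Invertibility preserving maps\<close>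


lemma
  assumes "clinear f"
  shows clinear_add: "f (x + y) = f x + f y"
    and clinear_scaleC: "f (c *\<^sub>C x) = c *\<^sub>C f x"
    and clinear_scaleR: "f (r *\<^sub>R x) = r *\<^sub>R f x"
  using assms by (simp_all add: clinear_iff scaleR_scaleC)

lemma clinear_zero: "clinear f \<Longrightarrow> f 0 = 0"
  using clinear_scaleC[of f 0 0] by (simp add: scaleC_zero_left)

lemma clinear_diff: "clinear f \<Longrightarrow> f (x - y) = f x - f y"
  by (metis clinear_add diff_add_cancel eq_diff_eq)

lemma clinear_sum: "clinear f \<Longrightarrow> f (\<Sum>i\<in>A. x i) = (\<Sum>i\<in>A. f (x i))"
  by (induction A rule: infinite_finite_induct) (simp_all add: clinear_zero clinear_add)

text \<open>The Neumann series makes \<open>1 - \<mu> x / R\<close> invertible on the closed unit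
  disc, and \<open>T\<close> transports this to the resolvent of \<open>T x / R\<close>. The
  constant \<open>C\<close> depends on \<open>x\<close>.\<close>

lemma invertibility_preserving_powers_bounded:
  fixes T :: "'b::complex_banach_algebra_1 \<Rightarrow> 'a::complex_banach_algebra_1"
  assumes T: "clinear T" "T 1 = 1" "T ` invertibles \<subseteq> invertibles" and x: "norm x < R"
  shows "\<exists>C. \<forall>m. norm (T x ^ m) \<le> C * R ^ m"
proof -
  have R: "0 < R" using x norm_ge_zero[of x] by linarith
  have "Bseq (\<lambda>m. ((1 / of_real R) *\<^sub>C T x) ^ m)"
  proof (rule powers_bounded_if_resolvent_on_disc)
    fix \<mu> :: complex assume \<mu>: "cmod \<mu> \<le> 1"
    have "norm (\<mu> *\<^sub>C (1 / of_real R) *\<^sub>C x) = cmod \<mu> * (norm x / R)"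
      using R by (simp add: norm_scaleC norm_divide)
    also have "\<dots> \<le> 1 * (norm x / R)" using \<mu> R by (intro mult_right_mono) auto
    also have "\<dots> < 1" using x R by simp
    finally have "1 - \<mu> *\<^sub>C (1 / of_real R) *\<^sub>C x \<in> invertibles" by (rule invertibles_one_minus)
    then have "T (1 - \<mu> *\<^sub>C (1 / of_real R) *\<^sub>C x) \<in> invertibles" using T(3) by blast
    then show "1 - \<mu> *\<^sub>C (1 / of_real R) *\<^sub>C T x \<in> invertibles"
      by (simp add: clinear_diff[OF T(1)] clinear_scaleC[OF T(1)] T(2))
  qed
  then obtain C where C: "\<And>m. norm (((1 / of_real R) *\<^sub>C T x) ^ m) \<le> C"
    unfolding Bseq_def by blast
  have "norm (T x ^ m) \<le> C * R ^ m" for m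
    using C[of m] R by (simp add: power_scaleC norm_scaleC norm_power norm_divide divide_simps)
  then show ?thesis by blast
qed

context finite_cstar
begin

context
  fixes T :: "'b::complex_banach_algebra_1 \<Rightarrow> 'a"
  assumes T: "clinear T" "T 1 = 1" "T ` invertibles \<subseteq> invertibles"
begin

lemma binomial_log_det_coefficients_bound:
  fixes a b :: 'b
  defines "c \<equiv> \<lambda>n j. T (binomial_product_coeff n a b j)"
  obtains B where
    "\<And>n. n \<ge> 1 \<Longrightarrow> cmod (\<tau> (2 *\<^sub>R c n 2 - c n 1 * c n 1)) \<le> B * real n"
    "\<And>n. n \<ge> 1 \<Longrightarrow> cmod (\<tau> (6 *\<^sub>R c n 3 - 6 *\<^sub>R (c n 1 * c n 2) + 2 *\<^sub>R (c n 1 * c n 1 * c n 1)))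
      \<le> B * real n"
proof -
  \<comment> \<open>This radius is independent of \<open>n\<close>. On its disc both
    \<open>z *\<^sub>C a\<close> and \<open>z *\<^sub>C b\<close> have norm at most 1/2, so each
    factor is invertible with norm at most 3/2; the product of the powers has norm at most
    \<open>(9/4) ^ n\<close>, below \<open>4 ^ n\<close>.\<close>
  define \<rho> where "\<rho> = 1 / (2 * (1 + norm a + norm b))"
  have pos: "0 < 1 + norm a + norm b" using norm_ge_zero[of a] norm_ge_zero[of b] by linarith
  then have \<rho>: "0 < \<rho>" by (simp add: \<rho>_def)
  have small: "norm (z *\<^sub>C x) \<le> 1/2" if "z \<in> ball 0 \<rho>" "norm x \<le> 1 + norm a + norm b" for z and x :: 'b
  proof -
    have "norm (z *\<^sub>C x) \<le> \<rho> * (1 + norm a + norm b)"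
      unfolding norm_scaleC using that \<rho> by (intro mult_mono) auto
    also have "\<dots> = 1/2" using pos by (simp add: \<rho>_def)
    finally show ?thesis .
  qed
  have na: "norm a \<le> 1 + norm a + norm b" and nb: "norm b \<le> 1 + norm a + norm b" by simp_all
  have factor: "1 + z *\<^sub>C x \<in> invertibles" "norm (1 + z *\<^sub>C x) \<le> 3/2"
    if "z \<in> ball 0 \<rho>" "norm x \<le> 1 + norm a + norm b" for z and x :: 'b
  proof -
    have "norm (- (z *\<^sub>C x)) < 1" using small[OF that] by simp
    from invertibles_one_minus[OF this] show "1 + z *\<^sub>C x \<in> invertibles" by simp
    show "norm (1 + z *\<^sub>C x) \<le> 3/2"
      using small[OF that] norm_triangle_ineq[of 1 "z *\<^sub>C x"] by simp
  qed
  define F where "F n z = T ((1 + z *\<^sub>C a) ^ n * (1 + z *\<^sub>C b) ^ n)" for n z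
  have F: "F n z = (\<Sum>j\<le>2 * n + 3. z ^ j *\<^sub>C c n j)" for n z
    unfolding F_def c_def
    by (simp add: binomial_product_expansion[of n "2 * n + 3"] clinear_sum[OF T(1)] clinear_scaleC[OF T(1)])
  have inv: "F n z \<in> invertibles" if "z \<in> ball 0 \<rho>" for n z
    unfolding F_def using T(3) factor(1)[OF that na] factor(1)[OF that nb]
    by (blast intro: invertibles_mult invertibles_power)
  have bound: "\<exists>C. \<forall>m. norm (F n z ^ m) \<le> C * (4 ^ n) ^ m" if z: "z \<in> ball 0 \<rho>" and n: "n \<ge> 1" for n z
  proof -
    have pw: "norm ((1 + z *\<^sub>C x) ^ n) \<le> (3/2) ^ n" if "norm x \<le> 1 + norm a + norm b" for x :: 'b
      by (rule order_trans[OF norm_power_ineq power_mono[OF factor(2)[OF z that] norm_ge_zero]])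
    have "norm ((1 + z *\<^sub>C a) ^ n * (1 + z *\<^sub>C b) ^ n) \<le> (3/2) ^ n * (3/2) ^ n"
      by (rule order_trans[OF norm_mult_ineq]) (intro mult_mono pw na nb, auto)
    also have "\<dots> = (9/4 :: real) ^ n" by (simp flip: power_mult_distrib)
    also have "\<dots> < 4 ^ n" using n by (intro power_strict_mono) auto
    finally show ?thesis
      unfolding F_def by (rule invertibility_preserving_powers_bounded[OF T])
  qed
  have c0: "c n 0 = 1" for n by (simp add: c_def binomial_product_coeff_low T)
  define B where "B = max (2 * (4 * ln 4) / (\<rho> / 2) ^ 2) (6 * (4 * ln 4) / (\<rho> / 2) ^ 3)"
  have ln: "ln (4 ^ n) = real n * ln (4::real)" for n by (simp add: ln_realpow)
  show thesis
  proof (rule that[of B])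
    fix n :: nat assume n: "n \<ge> 1"
    have R: "1 < (4::real) ^ n" using n by (intro one_less_power) auto
    note * = log_det_coefficients_bound[of \<rho> "4 ^ n" "2 * n + 3" "c n" "F n", OF \<rho> R _ c0 F inv bound[OF _ n]]
    note *(1)
    also have "2 * (4 * ln (4 ^ n)) / (\<rho> / 2) ^ 2 = 2 * (4 * ln 4) / (\<rho> / 2) ^ 2 * real n"
      unfolding ln by simp
    also have "\<dots> \<le> B * real n" unfolding B_def by (intro mult_right_mono) simp_all
    finally show "cmod (\<tau> (2 *\<^sub>R c n 2 - c n 1 * c n 1)) \<le> B * real n" by simp
    note *(2)
    also have "6 * (4 * ln (4 ^ n)) / (\<rho> / 2) ^ 3 = 6 * (4 * ln 4) / (\<rho> / 2) ^ 3 * real n"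
      unfolding ln by simp
    also have "\<dots> \<le> B * real n" unfolding B_def by (intro mult_right_mono) simp_all
    finally show "cmod (\<tau> (6 *\<^sub>R c n 3 - 6 *\<^sub>R (c n 1 * c n 2) + 2 *\<^sub>R (c n 1 * c n 1 * c n 1)))
      \<le> B * real n" by simp
  qed
qed

lemma tau_image_mult_symmetrized:
  "\<tau> (T (a * a)) + \<tau> (T (b * b)) + 2 * \<tau> (T (a * b)) = \<tau> (T (a + b) * T (a + b))"
proof -
  obtain B where B: "\<And>n. n \<ge> 1 \<Longrightarrow> cmod (\<tau> (2 *\<^sub>R T (binomial_product_coeff n a b 2)
      - T (binomial_product_coeff n a b 1) * T (binomial_product_coeff n a b 1))) \<le> B * real n"
    using binomial_log_det_coefficients_bound by blast
  define X where "X = \<tau> (T (a * a)) + \<tau> (T (b * b)) + 2 * \<tau> (T (a * b)) - \<tau> (T (a + b) * T (a + b))"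
  define Y where "Y = - (\<tau> (T (a * a)) + \<tau> (T (b * b)))"
  have "X = 0"
  proof (rule leading_coefficient_zero_if_growth_less[where Z = 0])
    fix n :: nat assume n: "n \<ge> 1"
    have "\<tau> (2 *\<^sub>R T (binomial_product_coeff n a b 2)
        - T (binomial_product_coeff n a b 1) * T (binomial_product_coeff n a b 1)) =
        X * of_nat n ^ 2 + Y * of_nat n"
      unfolding binomial_product_coeff_low
      by (simp add: clinear_add[OF T(1)] clinear_scaleR[OF T(1)] tau_diff tau_add tau_scaleR X_def Y_def
          real_choose_two scaleR_conv_of_real[where 'a=complex] power2_eq_square distrib_left distrib_right)
        (simp add: field_simps)
    then have "cmod (X * of_nat n ^ 2 + Y * of_nat n) \<le> B * real n" using B[OF n] by simp
    \<comment> \<open>Multiplication by \<open>n\<close> turns the quadratic comparison into the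
      cubic one handled by the growth lemma.\<close>
    then have "cmod (of_nat n * (X * of_nat n ^ 2 + Y * of_nat n)) \<le> real n * (B * real n)"
      unfolding norm_mult by (simp add: mult_left_mono)
    then show "cmod (X * of_nat n ^ 3 + Y * of_nat n ^ 2 + 0 * of_nat n) \<le> B * real n ^ 2"
      by (simp add: algebra_simps power3_eq_cube power2_eq_square)
  qed
  then show ?thesis by (simp add: X_def)
qed

text \<open>Taking \<open>b = 0\<close> settles squares. Removing them from the general identity
  isolates \<open>a * b\<close> in this order, so \<open>\<tau> \<circ> T\<close> turns out to be a
  trace on the domain.\<close>

lemma tau_image_mult: "\<tau> (T (a * b)) = \<tau> (T a * T b)"
proof -
  have sq: "\<tau> (T (x * x)) = \<tau> (T x * T x)" for x
    using tau_image_mult_symmetrized[of x 0] by (simp add: clinear_zero[OF T(1)] tau_zero)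
  show ?thesis
    using tau_image_mult_symmetrized[of a b] tau_commute[of "T b" "T a"]
    by (simp add: sq clinear_add[OF T(1)] distrib_left distrib_right tau_add)
qed

lemma tau_image_cube: "\<tau> (T (a * a * a)) = \<tau> (T a * T a * T a)"
proof -
  obtain B where B: "\<And>n. n \<ge> 1 \<Longrightarrow> cmod (\<tau> (6 *\<^sub>R T (binomial_product_coeff n a 0 3)
      - 6 *\<^sub>R (T (binomial_product_coeff n a 0 1) * T (binomial_product_coeff n a 0 2))
      + 2 *\<^sub>R (T (binomial_product_coeff n a 0 1) * T (binomial_product_coeff n a 0 1)
        * T (binomial_product_coeff n a 0 1)))) \<le> B * real n"
    using binomial_log_det_coefficients_bound by blast
  define s where "s = \<tau> (T (a * a * a))"
  define t where "t = \<tau> (T a * T a * T a)"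
  have q: "\<tau> (T a * T (a * a)) = s"
    using tau_image_mult[of a "a * a"] by (simp add: s_def mult.assoc)
  \<comment> \<open>By \<open>q\<close> the mixed term also has trace \<open>s\<close>: the cubic
    coefficient is \<open>s - 3 * s + 2 * t\<close>, and the quadratic ones cancel.\<close>
  have "2 * t - 2 * s = 0"
  proof (rule leading_coefficient_zero_if_growth_less[where Y = 0 and Z = "2 * s"])
    fix n :: nat assume n: "n \<ge> 1"
    have "\<tau> (6 *\<^sub>R T (binomial_product_coeff n a 0 3)
      - 6 *\<^sub>R (T (binomial_product_coeff n a 0 1) * T (binomial_product_coeff n a 0 2))
      + 2 *\<^sub>R (T (binomial_product_coeff n a 0 1) * T (binomial_product_coeff n a 0 1)
        * T (binomial_product_coeff n a 0 1))) =
      (2 * t - 2 * s) * of_nat n ^ 3 + 0 * of_nat n ^ 2 + 2 * s * of_nat n"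
      unfolding binomial_product_coeff_low
      by (simp add: clinear_add[OF T(1)] clinear_scaleR[OF T(1)] tau_diff tau_add tau_scaleR
          real_choose_two real_choose_three scaleR_conv_of_real[where 'a=complex] q flip: s_def t_def)
        (simp add: field_simps power2_eq_square power3_eq_cube)
    then have "cmod ((2 * t - 2 * s) * of_nat n ^ 3 + 0 * of_nat n ^ 2 + 2 * s * of_nat n) \<le> B * real n"
      using B[OF n] by simp
    also have "\<dots> \<le> B * real n ^ 2"
    proof -
      have "0 \<le> B * real n" using norm_ge_zero B[OF n] by (rule order_trans)
      then have "0 \<le> B" using n by (simp add: zero_le_mult_iff)
      then show ?thesis using n by (intro mult_left_mono) (simp_all add: power2_eq_square)
    qed
    finally show "cmod ((2 * t - 2 * s) * of_nat n ^ 3 + 0 * of_nat n ^ 2 + 2 * s * of_nat n)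
        \<le> B * real n ^ 2" .
  qed
  then show ?thesis by (simp add: s_def t_def)
qed

text \<open>The combination of \<open>q\<close> at \<open>a + b\<close>, \<open>a - b\<close> and
  \<open>b\<close> keeps exactly the terms quadratic in \<open>a\<close> and linear in
  \<open>b\<close>. Their three orderings agree, in the domain by \<open>tau_image_mult\<close> and
  in the range by traciality.\<close>

lemma tau_image_square_mult: "\<tau> (T (a * a) * T b) = \<tau> (T a * T a * T b)"
proof -
  define q where "q x = \<tau> (T (x * x * x)) - \<tau> (T x * T x * T x)" for x
  have q0: "q x = 0" for x by (simp add: q_def tau_image_cube)
  note rules = clinear_add[OF T(1)] clinear_diff[OF T(1)] tau_add tau_diff distrib_left distrib_right
    left_diff_distrib right_diff_distrib mult.assoc
  have s1: "\<tau> (T (a * (b * a))) = \<tau> (T (a * (a * b)))" "\<tau> (T (b * (a * a))) = \<tau> (T (a * (a * b)))"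
    using tau_image_mult[of a "b * a"] tau_image_mult[of "b * a" a] tau_image_mult[of b "a * a"]
      tau_image_mult[of "a * a" b] tau_commute[of "T a" "T (b * a)"] tau_commute[of "T b" "T (a * a)"]
    by (simp_all add: mult.assoc)
  have s2: "\<tau> (T a * (T b * T a)) = \<tau> (T a * (T a * T b))" "\<tau> (T b * (T a * T a)) = \<tau> (T a * (T a * T b))"
    using tau_commute[of "T a" "T b * T a"] tau_commute[of "T b" "T a * T a"] by (simp_all add: mult.assoc)
  have "q (a + b) - q (a - b) - 2 * q b = 6 * (\<tau> (T (a * (a * b))) - \<tau> (T a * (T a * T b)))"
    by (simp add: q_def rules s1 s2)
  then have "\<tau> (T (a * (a * b))) = \<tau> (T a * (T a * T b))" by (simp add: q0)
  then show ?thesis using tau_image_mult[of "a * a" b] by (simp add: mult.assoc)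
qed

lemma image_square:
  assumes "surj T"
  shows "T (a * a) = T a * T a"
proof -
  define d where "d = T (a * a) - T a * T a"
  obtain b where "T b = adj d" using assms by (metis surjD)
  then have "\<tau> (adj d * d) = 0"
    using tau_image_square_mult[of a b] tau_commute[of "adj d" d]
    by (simp add: d_def left_diff_distrib tau_diff)
  then show ?thesis using tau_faithful by (fastforce simp: d_def)
qed

end

end

theorem mainTheorem1:
  fixes T :: "'b::complex_banach_algebra_1 \<Rightarrow> 'a::cstar_algebra_1"
  assumes finite_A: "\<exists>\<tau> :: 'a \<Rightarrow> complex. faithful_tracial_state \<tau>"
    and linear_T: "clinear T"
    and surj_T: "surj T"
    and unital_T: "T 1 = 1"
    and invertible_T: "T ` invertibles \<subseteq> invertibles"
  shows "jordan_homomorphism T"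
proof -
  obtain \<tau> :: "'a \<Rightarrow> complex" where "faithful_tracial_state \<tau>" using finite_A ..
  then interpret finite_cstar \<tau> by unfold_locales
  show ?thesis
    using image_square[OF linear_T unital_T invertible_T surj_T] linear_T
    by (simp add: jordan_homomorphism_def power2_eq_square)
qed

end
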